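(* Let $G$ be a $k$-connected graph on $n$ vertices with $k\geq 2$. Then for any subset $Y$ of $V(G)$ with $|Y|=k-1$, $G$ contains a $Y$-cycle of length at least $\frac{2e(G)}{n-1}$.
   Context: All graphs are finite and simple. $e(G)$ denotes the number of edges of $G$. For $Y\subseteq V(G)$, a $Y$-cycle is a cycle of $G$ passing through all the vertices of $Y$. *)

theory Defs
  imports Complex_Main
begin

text \<open>A graph is given by its vertex set and its set of edges, an edge being an unordered pair of
  distinct vertices.\<close>

definition simple_graph :: "'a set \<Rightarrow> 'a set set \<Rightarrow> bool" where
  "simple_graph V E \<longleftrightarrow> finite V \<and> E \<subseteq> {e. e \<subseteq> V \<and> card e = 2}"

definition graph_path :: "'a set \<Rightarrow> 'a set set \<Rightarrow> 'a list \<Rightarrow> bool" where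
  "graph_path V E p \<longleftrightarrow>
     p \<noteq> [] \<and> set p \<subseteq> V \<and> distinct p \<and> successively (\<lambda>u v. {u, v} \<in> E) p"

text \<open>A cycle is listed by its vertices without repeating the first one at the end, so its length,
  i.e. its number of edges, is the length of the list.\<close>

definition graph_cycle :: "'a set \<Rightarrow> 'a set set \<Rightarrow> 'a list \<Rightarrow> bool" where
  "graph_cycle V E c \<longleftrightarrow> graph_path V E c \<and> length c \<ge> 3 \<and> {last c, hd c} \<in> E"

definition through_cycle :: "'a set \<Rightarrow> 'a set set \<Rightarrow> 'a set \<Rightarrow> 'a list \<Rightarrow> bool" where
  "through_cycle V E Y c \<longleftrightarrow> graph_cycle V E c \<and> Y \<subseteq> set c"

definition graph_connected :: "'a set \<Rightarrow> 'a set set \<Rightarrow> bool" where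
  "graph_connected V E \<longleftrightarrow>
     V \<noteq> {} \<and> (\<forall>u\<in>V. \<forall>v\<in>V. \<exists>p. graph_path V E p \<and> hd p = u \<and> last p = v)"

definition del_edges :: "'a set set \<Rightarrow> 'a set \<Rightarrow> 'a set set" where
  "del_edges E S = {e \<in> E. e \<inter> S = {}}"

text \<open>The requirement of more than \<open>k\<close> vertices makes the complete graph on \<open>m\<close> vertices
  \<open>k\<close>-connected exactly for \<open>k < m\<close>.\<close>

definition k_connected :: "nat \<Rightarrow> 'a set \<Rightarrow> 'a set set \<Rightarrow> bool" where
  "k_connected k V E \<longleftrightarrow>
     k < card V \<and> (\<forall>S. S \<subseteq> V \<and> card S < k \<longrightarrow> graph_connected (V - S) (del_edges E S))"

end

theory Submission
  imports Defs
begin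

text \<open>A longest \<open>Y\<close>-cycle \<open>c\<close>, of length \<open>l\<close>, spans at most \<open>l (l - 1) / 2\<close> edges, so with
  \<open>H = V - c\<close> it suffices that \<open>2 e(H) + 2 e(H, c) \<le> l |H|\<close>. For a component of \<open>H\<close> with \<open>s \<ge> k\<close>
  neighbours on \<open>c\<close>, any two of these are at distance at least \<open>2\<close> on \<open>c\<close>, and cutting \<open>c\<close> at a
  vertex of \<open>Y\<close> leaves at least \<open>s - k + 1\<close> gaps between consecutive neighbours that contain no vertex of
  \<open>Y\<close>. Such a gap is longer than every path through the component that could replace it, so
  \<open>l \<ge> 2 (s - 1) + q + 1\<close> for a path on \<open>q\<close> vertices. In a component without cut vertices the required path
  exists by a Fan-type theorem (a long path between two given attachments in terms of the average degree),
  which is in turn obtained by applying the same counting to the components left over by a longest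
  such path, with no forbidden vertices; the two statements are proved by a common induction on the size. A
  component with a cut vertex is handled by contracting a minimal end part into its cut vertex.

  A \<open>Y\<close>-cycle exists because a cycle through a maximal part of \<open>Y\<close> is split by it into fewer than \<open>k - 1\<close>
  segments: if the missing vertex had no two paths to the same segment, sharing only their start, then one
  vertex per segment would separate it from the cycle.\<close>

subsection \<open>Gaps between attachments\<close>

text \<open>The attachments are kept as bare sets of positions \<open>N v\<close>, detached from any
  actual cycle. Thus components of \<open>H\<close>, pieces with a contracted end part, and the rest
  of a longest path together with virtual vertices are all instances of one statement,
  \<open>gapped\<close> implies \<open>gap_bound\<close>, over a fixed edge set \<open>E\<close>.
  The induction closes because the path theorem for a set needs this statement only for proper
  subsets. The constant in \<open>l \<ge> 2 (s - 1) + q + 1\<close> arises as follows. If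
  \<open>P\<close> and \<open>Q\<close> are the vertices attached to the two ends of a gap, the path
  theorem bounds the degree sum plus \<open>2 |P| + 2 |Q|\<close> by \<open>(q + 3) |H|\<close>, the
  other \<open>s - 2\<close> positions contribute at most \<open>2 |H|\<close> each, and
  \<open>q + 3 + 2 (s - 2) = 2 (s - 1) + q + 1\<close>. The obstacle is that a gap helps only if its
  ends are attached to two different vertices, since otherwise a single vertex may be the only
  detour. Where no such gap exists, every vertex misses so many positions that trivial estimates
  suffice. With a cut vertex, the ends of a gap may also belong to different sides of it.\<close>

definition gaps :: "nat set \<Rightarrow> nat set \<Rightarrow> (nat \<times> nat) set" where
  "gaps T Y = {(t, t'). t \<in> T \<and> t' \<in> T \<and> t < t' \<and> T \<inter> {t<..<t'} = {} \<and> Y \<inter> {t<..<t'} = {}}"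

lemma finite_gaps: "finite T \<Longrightarrow> finite (gaps T Y)"
  by (rule finite_subset[of _ "T \<times> T"]) (auto simp: gaps_def)

lemma inj_on_fst_gaps: "inj_on fst (gaps T Y)"
proof (rule inj_onI)
  fix x y assume x: "x \<in> gaps T Y" and y: "y \<in> gaps T Y" and eq: "fst x = fst y"
  obtain t a b where [simp]: "x = (t, a)" "y = (t, b)"
    using eq by (metis prod.collapse)
  have "\<not> a < b" "\<not> b < a"
    using x y by (auto simp: gaps_def greaterThanLessThan_def)
  then show "x = y" by simp
qed

text \<open>Left ends determine gaps, and the largest element of \<open>Z\<close> is not the left
  end of a gap inside \<open>Z\<close>. Later counts rest on this surplus of one element per
  set.\<close>

lemma card_gaps_within:
  assumes "finite Z" "Z \<noteq> {}" "G \<subseteq> gaps T Y" "G \<subseteq> Z \<times> Z"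
  shows "card G < card Z"
proof -
  have "fst ` G \<subseteq> Z - {Max Z}"
  proof
    fix t assume "t \<in> fst ` G"
    then obtain t' where g: "(t, t') \<in> G" by auto
    then have "t < t'" using assms(3) by (auto simp: gaps_def)
    moreover have "t \<in> Z" "t' \<in> Z" using g assms(4) by auto
    ultimately show "t \<in> Z - {Max Z}"
      using Max_ge[OF assms(1), of t'] by auto
  qed
  then have "card (fst ` G) \<le> card (Z - {Max Z})"
    using assms(1) by (intro card_mono) auto
  moreover have "card (fst ` G) = card G"
    using inj_on_subset[OF inj_on_fst_gaps assms(3)] by (rule card_image)
  moreover have "card (Z - {Max Z}) < card Z"
    using assms by (intro card_Diff1_less) auto
  ultimately show ?thesis by simp
qed

text \<open>Every element of \<open>T\<close> but the last begins a gap unless an element of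
  \<open>Y\<close> lies before its successor. The intervals up to the successors are disjoint, so
  each element of \<open>Y\<close> spoils at most one gap.\<close>

lemma card_gaps_ge:
  assumes "finite T" "finite Y"
  shows "card T \<le> card (gaps T Y) + card Y + 1"
proof (cases "T = {}")
  case False
  \<comment> \<open>For \<open>t = Max T\<close> this is the minimum of the empty set, so all facts
    about \<open>nxt\<close> are restricted to \<open>T - {Max T}\<close>.\<close>
  define nxt where "nxt t = Min {x \<in> T. t < x}" for t
  define B where "B = {t \<in> T - {Max T}. Y \<inter> {t<..<nxt t} \<noteq> {}}"
  have nxt: "nxt t \<in> T" "t < nxt t" "\<And>x. x \<in> T \<Longrightarrow> t < x \<Longrightarrow> nxt t \<le> x"
    if "t \<in> T - {Max T}" for t
  proof -
    have "Max T \<in> T" "t < Max T"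
      using that False assms(1) by (auto simp: order_less_le)
    then have ne: "{x \<in> T. t < x} \<noteq> {}" by auto
    have "nxt t \<in> {x \<in> T. t < x}"
      unfolding nxt_def using ne assms(1) by (intro Min_in) auto
    then show "nxt t \<in> T" "t < nxt t" by auto
    show "nxt t \<le> x" if "x \<in> T" "t < x" for x
      unfolding nxt_def using that assms(1) by (intro Min_le) auto
  qed
  have "\<exists>f. \<forall>t\<in>B. f t \<in> Y \<inter> {t<..<nxt t}"
    by (intro bchoice) (auto simp: B_def)
  then obtain f where f: "\<And>t. t \<in> B \<Longrightarrow> f t \<in> Y \<inter> {t<..<nxt t}" by blast
  have "inj_on f B"
  proof (rule inj_onI)
    fix s t assume st: "s \<in> B" "t \<in> B" "f s = f t"
    have bs: "s \<in> T - {Max T}" "t \<in> T - {Max T}" using st by (auto simp: B_def)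
    have m: "s < f s" "f s < nxt s" "t < f s" "f s < nxt t" using f[OF st(1)] f[OF st(2)] st(3) by auto
    have "\<not> s < t" using nxt(3)[OF bs(1), of t] bs m by auto
    moreover have "\<not> t < s" using nxt(3)[OF bs(2), of s] bs m by auto
    ultimately show "s = t" by simp
  qed
  then have B: "card B \<le> card Y"
    using f assms(2) by (intro card_inj_on_le[of f]) auto
  have "T - {Max T} \<subseteq> fst ` gaps T Y \<union> B"
  proof
    fix t assume t: "t \<in> T - {Max T}"
    have "(t, nxt t) \<in> gaps T Y" if "t \<notin> B"
      using t that nxt[OF t] by (fastforce simp: gaps_def B_def)
    then show "t \<in> fst ` gaps T Y \<union> B" by force
  qed
  then have "card (T - {Max T}) \<le> card (fst ` gaps T Y \<union> B)"
    using assms(1) finite_gaps[OF assms(1)] by (intro card_mono) (auto simp: B_def)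
  also have "\<dots> \<le> card (fst ` gaps T Y) + card B" by (rule card_Un_le)
  also have "\<dots> \<le> card (gaps T Y) + card Y"
    using B finite_gaps[OF assms(1), of Y] by (intro add_mono card_image_le) auto
  finally show ?thesis by (simp add: card_Diff_singleton_if split: if_splits)
qed simp

text \<open>Every element of \<open>T\<close> occupies itself and the following position, and the
  gap additionally occupies \<open>{t + 2..<t'}\<close>. All this fits into one round
  \<open>{m..<m + c}\<close> of the cycle, where \<open>spread\<close> leaves room behind the last
  element.\<close>

lemma spaced_card_gap:
  fixes T :: "nat set"
  assumes fin: "finite T"
    and spaced: "\<And>x y. x \<in> T \<Longrightarrow> y \<in> T \<Longrightarrow> x < y \<Longrightarrow> x + 2 \<le> y"
    and spread: "\<And>x y. x \<in> T \<Longrightarrow> y \<in> T \<Longrightarrow> x + 2 \<le> c + y"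
    and t: "t \<in> T" "t' \<in> T" "t \<le> t'" "T \<inter> {t<..<t'} = {}"
  shows "2 * card T + (t' - t) \<le> c + 2"
proof -
  define m where "m = Min T"
  have m: "m \<in> T" "\<And>x. x \<in> T \<Longrightarrow> m \<le> x" 
    using Min_in[OF fin] Min_le[OF fin] t(1) unfolding m_def by blast+
  have "T \<inter> Suc ` T = {}"
    using spaced by fastforce
  then have "card (T \<union> Suc ` T) = 2 * card T"
    using fin by (simp add: card_Un_disjoint card_image)
  moreover have disj: "(T \<union> Suc ` T) \<inter> {t + 2..<t'} = {}"
  proof (intro equals0I)
    fix x assume x: "x \<in> (T \<union> Suc ` T) \<inter> {t + 2..<t'}"
    then have "x \<in> T \<inter> {t<..<t'} \<or> x - 1 \<in> T \<inter> {t<..<t'}" by auto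
    then show False using t(4) by auto
  qed
  moreover have "card ((T \<union> Suc ` T) \<union> {t + 2..<t'}) = card (T \<union> Suc ` T) + card {t + 2..<t'}"
    using fin disj by (intro card_Un_disjoint) auto
  moreover have "(T \<union> Suc ` T) \<union> {t + 2..<t'} \<subseteq> {m..<m + c}"
    using m spread[OF _ m(1)] t(1,2) by fastforce
  then have "card ((T \<union> Suc ` T) \<union> {t + 2..<t'}) \<le> c"
    using card_mono[of "{m..<m + c}"] by fastforce
  ultimately show ?thesis by simp
qed

text \<open>The outer boundary of \<open>W\<close> inside \<open>H\<close>. Connectivity of pieces
  is expressed through it: a union of components has an empty boundary, a part hanging at a cut
  vertex has a boundary of one element.\<close>

definition nbrs :: "'a set set \<Rightarrow> 'a set \<Rightarrow> 'a set \<Rightarrow> 'a set" where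
  "nbrs E H W = {x \<in> H - W. \<exists>w\<in>W. {w, x} \<in> E}"

text \<open>If every gap in \<open>F\<close> has both ends attached to a single common vertex, then the exclusive attachments
  of the vertices with at least two of them account for \<open>F\<close>; removing these vertices contradicts \<open>conn\<close>
  unless there is nothing else.\<close>

lemma gap_dichotomy:
  fixes N :: "'a \<Rightarrow> nat set"
  assumes fin: "finite A" "\<And>v. v \<in> A \<Longrightarrow> finite (N v)"
    and F: "F \<subseteq> gaps T Y" "F \<subseteq> (\<Union>(N ` A)) \<times> (\<Union>(N ` A))"
    and conn: "\<And>W. W \<subseteq> A \<Longrightarrow> W \<noteq> {} \<Longrightarrow> k \<le> card (nbrs E A W) + card (\<Union>(N ` W))"
    and many: "card (\<Union>(N ` A)) + 1 \<le> card F + k"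
  shows "(\<exists>t t' u u'. (t, t') \<in> F \<and> u \<in> A \<and> u' \<in> A \<and> u \<noteq> u' \<and> t \<in> N u \<and> t' \<in> N u') \<or>
    (\<forall>v\<in>A. card (N v) + 2 * (card A - 1) \<le> card (\<Union>(N ` A)))"
proof (rule disj_imp[THEN iffD2], rule impI)
  assume no: "\<not> (\<exists>t t' u u'. (t, t') \<in> F \<and> u \<in> A \<and> u' \<in> A \<and> u \<noteq> u' \<and> t \<in> N u \<and> t' \<in> N u')"
  let ?T = "\<Union>(N ` A)"
  have finT: "finite ?T" using fin by blast
  \<comment> \<open>The attachments exclusive to \<open>u\<close>. In the absence of a gap with two
    different end vertices, both ends of each gap in \<open>F\<close> are exclusive to the same
    vertex, which therefore lies in \<open>U\<close>.\<close>
  define X where "X u = N u - \<Union>(N ` (A - {u}))" for u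
  define U where "U = {u \<in> A. card (X u) \<ge> 2}"
  have XT: "X u \<subseteq> ?T" if "u \<in> A" for u using that by (auto simp: X_def)
  have finX: "finite (X u)" if "u \<in> A" for u using that fin(2) by (auto simp: X_def)
  have UA: "U \<subseteq> A" by (auto simp: U_def)
  have finU: "finite U" using fin by (auto simp: U_def)
  have disjX: "X u \<inter> X v = {}" if "u \<in> A" "v \<in> A" "u \<noteq> v" for u v
    using that by (auto simp: X_def)
  have cardUn: "card (\<Union>(X ` B)) = (\<Sum>u\<in>B. card (X u))" if "B \<subseteq> A" for B
    using that disjX finX finite_subset[OF that fin(1)] by (intro card_UN_disjoint) blast+
  define Fu where "Fu u = F \<inter> (X u \<times> X u)" for u
  have Fu: "card (Fu u) < card (X u)" if "u \<in> U" for u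
    using that F finX by (intro card_gaps_within[of _ _ T Y]) (auto simp: Fu_def U_def)
  have sub: "F \<subseteq> (\<Union>u\<in>U. Fu u)"
  proof
    fix x assume x: "x \<in> F"
    obtain t t' where [simp]: "x = (t, t')" by force
    obtain u u' where u: "u \<in> A" "t \<in> N u" "u' \<in> A" "t' \<in> N u'" using x F(2) by auto
    have eq: "w = w'" if "w \<in> A" "t \<in> N w" "w' \<in> A" "t' \<in> N w'" for w w'
      using no x that by auto
    have only: "w = u" if "w \<in> A" "t \<in> N w \<or> t' \<in> N w" for w
      using that eq[OF _ _ u(3,4)] eq[OF u(1,2)] u by metis
    have t'u: "t' \<in> N u" using eq[OF u] u by simp
    have "t \<in> X u" using u(2) only unfolding X_def by blast
    have "t' \<in> X u" using t'u only unfolding X_def by blast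
    have "t \<noteq> t'" using x F(1) by (auto simp: gaps_def)
    then have "card (X u) \<ge> 2"
      using card_mono[OF finX[OF u(1)], of "{t, t'}"] \<open>t \<in> X u\<close> \<open>t' \<in> X u\<close> by simp
    then show "x \<in> (\<Union>u\<in>U. Fu u)"
      using u(1) x \<open>t \<in> X u\<close> \<open>t' \<in> X u\<close> unfolding U_def Fu_def by auto
  qed
  have finFu: "finite (Fu u)" if "u \<in> U" for u
    using that finX by (auto simp: Fu_def U_def)
  have "card F \<le> card (\<Union>u\<in>U. Fu u)"
    using sub finFu finU by (intro card_mono) auto
  also have "\<dots> \<le> (\<Sum>u\<in>U. card (Fu u))"
    using finU by (rule card_UN_le)
  finally have "card F + card U \<le> (\<Sum>u\<in>U. card (Fu u) + 1)"
    unfolding sum.distrib by simp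
  also have "\<dots> \<le> (\<Sum>u\<in>U. card (X u))"
    using Fu by (intro sum_mono) (simp add: Suc_leI)
  also have "\<dots> = card (\<Union>(X ` U))"
    using cardUn[OF UA] by simp
  finally have cF: "card F + card U \<le> card (\<Union>(X ` U))" .
  \<comment> \<open>Otherwise \<open>A - U\<close> has its boundary in \<open>U\<close> and sees
    none of the exclusive attachments of \<open>U\<close>, so \<open>conn\<close> bounds
    \<open>k\<close> by \<open>card ?T - card F\<close>, against \<open>many\<close>.\<close>
  have "U = A"
  proof (rule ccontr)
    assume "U \<noteq> A"
    then have W: "A - U \<subseteq> A" "A - U \<noteq> {}" by (auto simp: U_def)
    have "nbrs E A (A - U) \<subseteq> U" by (auto simp: nbrs_def)
    then have 1: "card (nbrs E A (A - U)) \<le> card U" using finU by (intro card_mono)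
    have "\<Union>(N ` (A - U)) \<subseteq> ?T - \<Union>(X ` U)" by (auto simp: X_def U_def)
    then have "card (\<Union>(N ` (A - U))) \<le> card (?T - \<Union>(X ` U))"
      using finT by (intro card_mono) auto
    also have "\<dots> = card ?T - card (\<Union>(X ` U))"
      using XT finT by (intro card_Diff_subset) (auto simp: U_def intro: finite_subset)
    finally have 2: "card (\<Union>(N ` (A - U))) \<le> card ?T - card (\<Union>(X ` U))" .
    have "card (\<Union>(X ` U)) \<le> card ?T"
      using finT XT by (intro card_mono) (auto simp: U_def)
    then show False using conn[OF W] 1 2 cF many by linarith
  qed
  show "\<forall>v\<in>A. card (N v) + 2 * (card A - 1) \<le> card ?T"
  proof
    fix v assume v: "v \<in> A"
    have "2 * (card A - 1) = (\<Sum>u\<in>A - {v}. 2)" using v by simp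
    also have "\<dots> \<le> (\<Sum>u\<in>A - {v}. card (X u))"
      using \<open>U = A\<close> by (intro sum_mono) (auto simp: U_def)
    also have "\<dots> = card (\<Union>(X ` (A - {v})))" using cardUn[of "A - {v}"] by auto
    finally have "card (N v) + 2 * (card A - 1) \<le> card (N v) + card (\<Union>(X ` (A - {v})))" by simp
    also have "\<dots> = card (N v \<union> \<Union>(X ` (A - {v})))"
      using v fin finX by (intro card_Un_disjoint[symmetric]) (auto simp: X_def)
    also have "\<dots> \<le> card ?T"
      using finT v by (intro card_mono) (auto simp: X_def)
    finally show "card (N v) + 2 * (card A - 1) \<le> card ?T" .
  qed
qed

subsection \<open>Paths and degree sums\<close>

lemma graph_path_mono: "graph_path A E p \<Longrightarrow> A \<subseteq> B \<Longrightarrow> graph_path B E p"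
  by (auto simp: graph_path_def)

lemma graph_path_single: "v \<in> A \<Longrightarrow> graph_path A E [v]"
  by (simp add: graph_path_def)

lemma graph_path_rev: "graph_path A E (rev p) \<longleftrightarrow> graph_path A E p"
  by (simp add: graph_path_def insert_commute)

lemma graph_path_append:
  assumes "p \<noteq> []" "q \<noteq> []"
  shows "graph_path A E (p @ q) \<longleftrightarrow>
    graph_path A E p \<and> graph_path A E q \<and> set p \<inter> set q = {} \<and> {last p, hd q} \<in> E"
  using assms by (auto simp: graph_path_def successively_append_iff)

lemma graph_path_Cons:
  assumes "p \<noteq> []"
  shows "graph_path A E (v # p) \<longleftrightarrow> v \<in> A \<and> v \<notin> set p \<and> {v, hd p} \<in> E \<and> graph_path A E p"
  using assms graph_path_append[of "[v]" p A E] by (auto simp: graph_path_def)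

lemma graph_path_length:
  assumes "finite A" "graph_path A E p"
  shows "length p \<le> card A"
  using assms by (metis card_mono distinct_card graph_path_def)

lemma nbrs_subset: "nbrs E H W \<subseteq> H - W"
  by (auto simp: nbrs_def)

lemma finite_nbrs: "finite H \<Longrightarrow> finite (nbrs E H W)"
  by (auto simp: nbrs_def)

text \<open>The set of vertices reachable from \<open>x\<close> has empty boundary, so
  \<open>meets\<close> forces it to meet \<open>Q\<close>. This is how conditions on boundaries are
  turned into paths.\<close>

lemma graph_path_to:
  assumes "finite H" "x \<in> H"
    and meets: "\<And>D. D \<subseteq> H \<Longrightarrow> x \<in> D \<Longrightarrow> nbrs E H D = {} \<Longrightarrow> D \<inter> Q \<noteq> {}"
  obtains p where "graph_path H E p" "hd p = x" "last p \<in> Q"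
proof -
  define D where "D = {v. \<exists>p. graph_path H E p \<and> hd p = x \<and> last p = v}"
  have "D \<subseteq> H" by (auto simp: D_def graph_path_def)
  moreover have "x \<in> D"
    using assms(2) by (auto simp: D_def intro!: exI[of _ "[x]"] graph_path_single)
  moreover have "nbrs E H D = {}"
  proof (intro equals0I)
    fix z assume "z \<in> nbrs E H D"
    then obtain w where z: "z \<in> H" "z \<notin> D" and w: "w \<in> D" "{w, z} \<in> E" by (auto simp: nbrs_def)
    obtain p where p: "graph_path H E p" "hd p = x" "last p = w" using w by (auto simp: D_def)
    have "p \<noteq> []" using p by (auto simp: graph_path_def)
    have "z \<notin> set p"
    proof
      assume "z \<in> set p"
      then obtain a b where ab: "p = a @ z # b" by (meson split_list)
      then have "graph_path H E (a @ [z])"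
        using p(1) by (auto simp: graph_path_def successively_append_iff)
      moreover have "hd (a @ [z]) = x" using p(2) ab by (cases a) auto
      ultimately have "z \<in> D" unfolding D_def by (intro CollectI exI[of _ "a @ [z]"]) simp
      then show False using z by simp
    qed
    then have "graph_path H E (p @ [z])"
      using p z w \<open>p \<noteq> []\<close> by (simp add: graph_path_append graph_path_single)
    moreover have "hd (p @ [z]) = x" using p \<open>p \<noteq> []\<close> by simp
    ultimately have "z \<in> D" unfolding D_def by (intro CollectI exI[of _ "p @ [z]"]) simp
    then show False using z by simp
  qed
  ultimately have "D \<inter> Q \<noteq> {}" by (rule meets)
  then show thesis using that by (auto simp: D_def)
qed

text \<open>Ordered pairs, so that inside one set every edge counts twice, which is the degree sum,
  and between disjoint sets once.\<close>

definition arcs :: "'a set set \<Rightarrow> 'a set \<Rightarrow> 'a set \<Rightarrow> ('a \<times> 'a) set" where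
  "arcs E A B = {(u, v). u \<in> A \<and> v \<in> B \<and> {u, v} \<in> E}"

lemma finite_arcs: "finite A \<Longrightarrow> finite B \<Longrightarrow> finite (arcs E A B)"
  by (rule finite_subset[of _ "A \<times> B"]) (auto simp: arcs_def)

lemma card_arcs_commute: "card (arcs E A B) = card (arcs E B A)"
proof -
  have "arcs E B A = prod.swap ` arcs E A B" by (force simp: arcs_def insert_commute)
  then show ?thesis by (simp add: card_image)
qed

lemma card_arcs_Un_left:
  assumes "finite A" "finite A'" "finite B" "A \<inter> A' = {}"
  shows "card (arcs E (A \<union> A') B) = card (arcs E A B) + card (arcs E A' B)"
proof -
  have "arcs E (A \<union> A') B = arcs E A B \<union> arcs E A' B" by (auto simp: arcs_def)
  moreover have "arcs E A B \<inter> arcs E A' B = {}" using assms(4) by (auto simp: arcs_def)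
  ultimately show ?thesis using assms by (simp add: card_Un_disjoint finite_arcs)
qed

lemma card_arcs_Un:
  assumes "finite A" "finite B" "A \<inter> B = {}"
  shows "card (arcs E (A \<union> B) (A \<union> B)) = card (arcs E A A) + 2 * card (arcs E A B) + card (arcs E B B)"
proof -
  have "card (arcs E X (A \<union> B)) = card (arcs E X A) + card (arcs E X B)" if "finite X" for X
    unfolding card_arcs_commute[of E X] using that assms by (intro card_arcs_Un_left)
  then show ?thesis
    using assms by (simp add: card_arcs_Un_left card_arcs_commute[of E B A])
qed

lemma card_arcs_sum:
  assumes "finite A" "finite B"
  shows "card (arcs E A B) = (\<Sum>u\<in>A. card {v \<in> B. {u, v} \<in> E})"
proof -
  have "arcs E A B = (SIGMA u:A. {v \<in> B. {u, v} \<in> E})" by (auto simp: arcs_def)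
  then show ?thesis using assms by simp
qed

lemma card_arcs_self_le:
  assumes "finite A" "\<And>v. {v} \<notin> E"
  shows "card (arcs E A A) \<le> card A * (card A - 1)"
proof -
  have "card (arcs E A A) = (\<Sum>u\<in>A. card {v \<in> A. {u, v} \<in> E})"
    using assms by (simp add: card_arcs_sum)
  also have "\<dots> \<le> (\<Sum>u\<in>A. card (A - {u}))"
    using assms by (intro sum_mono card_mono) auto
  also have "\<dots> = card A * (card A - 1)" by simp
  finally show ?thesis .
qed

subsection \<open>Long paths between two attachment sets\<close>

text \<open>Here \<open>N v\<close> stands for the positions of the neighbours of \<open>v\<close> on a cycle of length \<open>c\<close> listed from a
  vertex of the prescribed set, and \<open>Y\<close> for the positions of its other vertices. The last two conditions
  say that a detour through \<open>H\<close> avoiding \<open>Y\<close> does not lengthen the cycle; the very last one concerns the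
  gap from the last position back to position \<open>0\<close>, for which a weak form suffices.\<close>

definition gapped :: "'a set set \<Rightarrow> nat \<Rightarrow> nat set \<Rightarrow> nat \<Rightarrow> 'a set \<Rightarrow> ('a \<Rightarrow> nat set) \<Rightarrow> bool" where
  "gapped E k Y c H N \<longleftrightarrow>
     finite H \<and> (\<forall>v\<in>H. finite (N v)) \<and> finite Y \<and> card Y + 2 \<le> k \<and>
     (\<forall>W. W \<subseteq> H \<and> W \<noteq> {} \<longrightarrow> k \<le> card (nbrs E H W) + card (\<Union>(N ` W))) \<and>
     (\<forall>p t t'. graph_path H E p \<and> t \<in> N (hd p) \<and> t' \<in> N (last p) \<and> t < t' \<and> Y \<inter> {t<..<t'} = {}
        \<longrightarrow> t + length p + 1 \<le> t') \<and>
     (\<forall>p t t'. graph_path H E p \<and> t \<in> N (hd p) \<and> t' \<in> N (last p) \<longrightarrow> t + 2 \<le> c + t')"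

text \<open>For a real cycle this is \<open>2 e(H) + 2 e(H, c) \<le> l |H|\<close>. The sum may also
  count adjacencies to virtual vertices, or inherited from a contracted part, that are not edges of
  \<open>E\<close>.\<close>

definition gap_bound :: "'a set set \<Rightarrow> nat \<Rightarrow> 'a set \<Rightarrow> ('a \<Rightarrow> nat set) \<Rightarrow> bool" where
  "gap_bound E c H N \<longleftrightarrow> card (arcs E H H) + 2 * (\<Sum>v\<in>H. card (N v)) \<le> c * card H"

text \<open>The positions on a longest path \<open>p\<close> from \<open>P\<close> to \<open>Q\<close>, preceded by a virtual vertex joined to
  \<open>P\<close> and followed by one joined to \<open>Q\<close>, satisfy \<open>gapped\<close> for \<open>k = 2\<close> and the length \<open>length p + 3\<close> of
  the cycle closed by a third virtual vertex.\<close>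

lemma long_path_bound:
  fixes H P Q :: "'a set"
  assumes loopless: "\<And>v. {v} \<notin> E"
    and IH: "\<And>H' k Y c (N :: 'a \<Rightarrow> nat set). H' \<subset> H \<Longrightarrow> gapped E k Y c H' N \<Longrightarrow> gap_bound E c H' N"
    and H: "finite H" "P \<subseteq> H" "Q \<subseteq> H"
    and two: "\<And>W. W \<subseteq> H \<Longrightarrow> W \<noteq> {} \<Longrightarrow>
      2 \<le> card (nbrs E H W) + of_bool (W \<inter> P \<noteq> {}) + of_bool (W \<inter> Q \<noteq> {})"
    and short: "\<And>p. graph_path H E p \<Longrightarrow> hd p \<in> P \<Longrightarrow> last p \<in> Q \<Longrightarrow> length p \<le> q"
  shows "card (arcs E H H) + 2 * card P + 2 * card Q \<le> (q + 3) * card H"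
proof (cases "H = {}")
  case True
  then show ?thesis using H by (simp add: arcs_def)
next
  case False
  have full: "nbrs E H H = {}" by (auto simp: nbrs_def)
  have "P \<noteq> {}" using two[of H] False full H by (auto simp: of_bool_def split: if_splits)
  then obtain x where x: "x \<in> P" by auto
  have "\<exists>p. graph_path H E p \<and> hd p \<in> P \<and> last p \<in> Q"
  proof -
    \<comment> \<open>A set with empty boundary can reach the value 2 in \<open>two\<close> only by
      meeting both \<open>P\<close> and \<open>Q\<close>.\<close>
    have "D \<inter> Q \<noteq> {}" if "D \<subseteq> H" "x \<in> D" "nbrs E H D = {}" for D
    proof -
      have "2 \<le> card (nbrs E H D) + of_bool (D \<inter> P \<noteq> {}) + of_bool (D \<inter> Q \<noteq> {})"
        using that by (intro two) auto
      then show ?thesis using that by (auto simp: of_bool_def split: if_splits)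
    qed
    then obtain p where "graph_path H E p" "hd p = x" "last p \<in> Q"
      using graph_path_to[of H x E Q] x H by blast
    then show ?thesis using x by blast
  qed
  then obtain p0 where p0: "graph_path H E p0 \<and> hd p0 \<in> P \<and> last p0 \<in> Q" by blast
  have "\<forall>p'. graph_path H E p' \<and> hd p' \<in> P \<and> last p' \<in> Q \<longrightarrow> length p' < card H + 1"
    using graph_path_length[OF H(1)] by (auto simp: less_Suc_eq_le)
  from ex_has_greatest_nat[of "\<lambda>p. graph_path H E p \<and> hd p \<in> P \<and> last p \<in> Q", OF p0 this]
  obtain p where p: "graph_path H E p" "hd p \<in> P" "last p \<in> Q"
    and longest: "\<And>p'. graph_path H E p' \<Longrightarrow> hd p' \<in> P \<Longrightarrow> last p' \<in> Q \<Longrightarrow> length p' \<le> length p"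
    by (elim exE conjE) metis
  define r where "r = length p"
  have pne: "p \<noteq> []" and pH: "set p \<subseteq> H" and pd: "distinct p"
    and ps: "successively (\<lambda>u v. {u, v} \<in> E) p" using p(1) by (auto simp: graph_path_def)
  have r: "r > 0" using pne by (simp add: r_def)
  define H' where "H' = H - set p"
  define M where "M v = {i. i < r \<and> {v, p ! i} \<in> E}" for v
  define N where "N v = Suc ` M v \<union> (if v \<in> P then {0} else {}) \<union> (if v \<in> Q then {r + 1} else {})" for v
  have finM: "finite (M v)" for v by (simp add: M_def)
  have finN: "finite (N v)" for v by (simp add: N_def finM)
  have cardM: "card (M v) = card {u \<in> set p. {v, u} \<in> E}" for v
  proof (rule bij_betw_same_card)
    show "bij_betw ((!) p) (M v) {u \<in> set p. {v, u} \<in> E}"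
      using pd by (auto simp: bij_betw_def M_def r_def inj_on_def nth_eq_iff_index_eq in_set_conv_nth)
  qed
  have cardN: "card (N v) = card {u \<in> set p. {v, u} \<in> E} + of_bool (v \<in> P) + of_bool (v \<in> Q)" for v
  proof -
    have "card (N v) = card (Suc ` M v \<union> (if v \<in> P then {0} else {})) + of_bool (v \<in> Q)"
      unfolding N_def by (subst card_Un_disjoint) (auto simp: M_def)
    also have "card (Suc ` M v \<union> (if v \<in> P then {0} else {})) = card (Suc ` M v) + of_bool (v \<in> P)"
      by (subst card_Un_disjoint) (auto simp: M_def)
    also have "card (Suc ` M v) = card (M v)" by (simp add: card_image)
    finally show ?thesis by (simp add: cardM)
  qed
  have "gapped E 2 {} (r + 3) H' N"
    unfolding gapped_def
  proof (intro conjI allI impI ballI; (elim conjE)?)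
    fix W assume W: "W \<subseteq> H'" "W \<noteq> {}"
    define I where "I = {i. i < r \<and> (\<exists>w\<in>W. {w, p ! i} \<in> E)}"
    have I: "(\<Union>v\<in>W. Suc ` M v) = Suc ` I" by (auto simp: M_def I_def)
    have "\<Union>(N ` W) = Suc ` I \<union> (if W \<inter> P \<noteq> {} then {0} else {}) \<union> (if W \<inter> Q \<noteq> {} then {r + 1} else {})"
      unfolding I[symmetric] by (auto simp: N_def split: if_splits)
    also have "card \<dots> = card (Suc ` I \<union> (if W \<inter> P \<noteq> {} then {0} else {})) + of_bool (W \<inter> Q \<noteq> {})"
      by (subst card_Un_disjoint) (auto simp: I_def)
    also have "card (Suc ` I \<union> (if W \<inter> P \<noteq> {} then {0} else {})) = card (Suc ` I) + of_bool (W \<inter> P \<noteq> {})"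
      by (subst card_Un_disjoint) (auto simp: I_def)
    also have "card (Suc ` I) = card I" by (simp add: card_image)
    finally have 1: "card (\<Union>(N ` W)) = card I + of_bool (W \<inter> P \<noteq> {}) + of_bool (W \<inter> Q \<noteq> {})" .
    have "nbrs E H W \<subseteq> nbrs E H' W \<union> (!) p ` I"
      using W by (auto simp: nbrs_def H'_def I_def in_set_conv_nth r_def)
    then have "card (nbrs E H W) \<le> card (nbrs E H' W \<union> (!) p ` I)"
      using H(1) by (intro card_mono finite_UnI finite_subset[OF nbrs_subset]) (auto simp: H'_def I_def)
    also have "\<dots> \<le> card (nbrs E H' W) + card ((!) p ` I)" by (rule card_Un_le)
    also have "\<dots> \<le> card (nbrs E H' W) + card I"
      by (intro add_left_mono card_image_le) (simp add: I_def)
    finally have 2: "card (nbrs E H W) \<le> card (nbrs E H' W) + card I" .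
    have "W \<subseteq> H" using W by (auto simp: H'_def)
    from two[OF this W(2)] 1 2 show "2 \<le> card (nbrs E H' W) + card (\<Union>(N ` W))"
      by linarith
  next
    fix s t t' assume s: "graph_path H' E s" "t \<in> N (hd s)" "t' \<in> N (last s)" "t < t'"
    have sne: "s \<noteq> []" and sH: "set s \<subseteq> H'" using s(1) by (auto simp: graph_path_def)
    \<comment> \<open>Position \<open>t\<close> belongs to \<open>p ! (t - 1)\<close>, so
      \<open>s\<close> replaces the vertices of \<open>p\<close> strictly between the indices
      \<open>t - 1\<close> and \<open>t' - 1\<close>. For \<open>t = 0\<close> the new path starts
      with \<open>s\<close>, in \<open>P\<close>; for \<open>t' = r + 1\<close> it ends with
      \<open>s\<close>, in \<open>Q\<close>.\<close>
    let ?a = "take t p" and ?b = "drop (t' - 1) p"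
    have tr: "t < r + 1" "t' \<le> r + 1" "0 < t'"
      using s(3,4) by (auto simp: N_def M_def split: if_splits)
    have 1: "{last ?a, hd s} \<in> E \<and> t \<le> r" if ne: "?a \<noteq> []"
    proof -
      obtain i where "t = Suc i" "i < r" "{hd s, p ! i} \<in> E"
        using ne s(2,4) tr by (auto simp: N_def M_def split: if_splits)
      then show ?thesis by (simp add: r_def take_Suc_conv_app_nth insert_commute)
    qed
    have 2: "{last s, hd ?b} \<in> E" if ne: "?b \<noteq> []"
    proof -
      obtain i where "t' = Suc i" "i < r" "{last s, p ! i} \<in> E"
        using ne s(3,4) tr by (auto simp: N_def M_def r_def split: if_splits)
      then show ?thesis by (simp add: r_def hd_drop_conv_nth)
    qed
    have disj: "set ?a \<inter> set ?b = {}"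
      using s(4) by (intro set_take_disj_set_drop_if_distinct pd) auto
    have "set s \<inter> set p = {}" using sH by (auto simp: H'_def)
    then have disj': "set s \<inter> set ?a = {}" "set s \<inter> set ?b = {}"
      by (auto dest: in_set_takeD in_set_dropD)
    have succ: "successively (\<lambda>u v. {u, v} \<in> E) ?a" "successively (\<lambda>u v. {u, v} \<in> E) ?b"
      using ps by (metis append_take_drop_id successively_append_iff)+
    have "graph_path H E (?a @ s @ ?b)"
      using s(1) 1 2 disj disj' succ sne pH pd
      by (auto simp: graph_path_def successively_append_iff H'_def dest: in_set_takeD in_set_dropD)
    moreover have "hd (?a @ s @ ?b) \<in> P"
      using p(2) s(2) sne tr pne r by (cases "t = 0") (auto simp: N_def M_def hd_append split: if_splits)
    moreover have "last (?a @ s @ ?b) \<in> Q"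
    proof (cases "t' = r + 1")
      case True
      then show ?thesis using s(3) sne by (auto simp: N_def M_def r_def split: if_splits)
    next
      case False
      then have "t' - 1 < length p" using tr by (auto simp: r_def)
      then show ?thesis using p(3) by (simp add: last_append)
    qed
    ultimately have "length (?a @ s @ ?b) \<le> r" unfolding r_def by (rule longest)
    then show "t + length s + 1 \<le> t'" using tr s(4) by (auto simp: r_def)
  next
    fix s t t' assume "t \<in> N (hd s)"
    then have "t \<le> r + 1" by (auto simp: N_def M_def split: if_splits)
    \<comment> \<open>Position \<open>r + 2\<close>, that of the third virtual vertex, is never an
      attachment. With the length \<open>r + 2\<close> instead, \<open>t = r + 1\<close> and
      \<open>t' = 0\<close> would violate this condition.\<close>
    then show "t + 2 \<le> r + 3 + t'" by simp
  next
    show "finite H'" using H(1) by (simp add: H'_def)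
  next
    fix v show "finite (N v)" by (rule finN)
  qed simp_all
  moreover have "H' \<subset> H" using pH hd_in_set[OF pne] unfolding H'_def by blast
  ultimately have "gap_bound E (r + 3) H' N" by (intro IH)
  moreover have fH': "finite H'" using H(1) by (simp add: H'_def)
  have "(\<Sum>v\<in>H'. of_bool (v \<in> R)) = card (H' \<inter> R)" for R
    using fH' by simp
  then have "(\<Sum>v\<in>H'. card (N v)) = card (arcs E H' (set p)) + card (H' \<inter> P) + card (H' \<inter> Q)"
    unfolding cardN sum.distrib card_arcs_sum[OF fH' finite_set] by simp
  moreover have "H = H' \<union> set p" "H' \<inter> set p = {}" using pH by (auto simp: H'_def)
  then have "card (arcs E H H) = card (arcs E H' H') + 2 * card (arcs E H' (set p)) + card (arcs E (set p) (set p))"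
    using card_arcs_Un[of H' "set p" E] H(1) by (simp add: H'_def)
  moreover have cp: "card (set p) = r" using pd by (simp add: distinct_card r_def)
  then have "card (arcs E (set p) (set p)) \<le> r * (r - 1)"
    using card_arcs_self_le[of "set p" E] loopless by simp
  moreover have "card P \<le> card (H' \<inter> P) + r" "card Q \<le> card (H' \<inter> Q) + r"
  proof -
    have "card R \<le> card (H' \<inter> R) + card (set p)" if "R \<subseteq> H" for R
    proof -
      have "card R \<le> card ((H' \<inter> R) \<union> set p)"
        using that H(1) by (intro card_mono) (auto simp: H'_def)
      also have "\<dots> \<le> card (H' \<inter> R) + card (set p)" by (rule card_Un_le)
      finally show ?thesis .
    qed
    then show "card P \<le> card (H' \<inter> P) + r" "card Q \<le> card (H' \<inter> Q) + r" using H(2,3) cp by auto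
  qed
  moreover have "card H = card H' + r"
    using pH cp H(1) card_mono[OF H(1) pH] by (simp add: H'_def card_Diff_subset)
  \<comment> \<open>The path contributes at most \<open>r (r - 1)\<close> by its own degree sum and
    \<open>4 r\<close> through \<open>P\<close> and \<open>Q\<close>, together
    \<open>(r + 3) r\<close>. This is the origin of the \<open>3\<close> in the bound.\<close>
  ultimately have "card (arcs E H H) + 2 * card P + 2 * card Q \<le> (r + 3) * card H' + r * (r - 1) + 4 * r"
    by (simp add: gap_bound_def)
  also have "\<dots> = (r + 3) * card H"
    using r \<open>card H = card H' + r\<close> by (cases r) (auto simp: algebra_simps)
  also have "\<dots> \<le> (q + 3) * card H"
    using short[OF p] by (simp add: r_def)
  finally show ?thesis .
qed

subsection \<open>Components without cut vertices\<close>

lemma spaced_card: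
  fixes T :: "nat set"
  assumes fin: "finite T"
    and spaced: "\<And>x y. x \<in> T \<Longrightarrow> y \<in> T \<Longrightarrow> x < y \<Longrightarrow> x + 2 \<le> y"
    and spread: "\<And>x y. x \<in> T \<Longrightarrow> y \<in> T \<Longrightarrow> x + 2 \<le> c + y"
  shows "2 * card T \<le> c"
proof (cases "T = {}")
  case False
  define m where "m = Min T"
  have m: "m \<in> T" "\<And>x. x \<in> T \<Longrightarrow> m \<le> x"
    using Min_in[OF fin] Min_le[OF fin] False unfolding m_def by blast+
  have "T \<inter> Suc ` T = {}"
    using spaced by fastforce
  then have "2 * card T = card (T \<union> Suc ` T)"
    using fin by (simp add: card_Un_disjoint card_image)
  also have "T \<union> Suc ` T \<subseteq> {m..<m + c}"
    using m spread[OF _ m(1)] by fastforce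
  then have "card (T \<union> Suc ` T) \<le> c"
    using card_mono[of "{m..<m + c}"] by fastforce
  finally show ?thesis .
qed simp

text \<open>Positions outside \<open>S\<close> are charged \<open>card A\<close> each. Only for
  those in \<open>S\<close>, which will be ends of a gap, is the exact number of attached vertices
  kept, as it occurs in the path theorem.\<close>

lemma sum_card_le:
  fixes N :: "'a \<Rightarrow> 'b set"
  assumes fin: "finite A" "finite T" and N: "\<And>v. v \<in> A \<Longrightarrow> N v \<subseteq> T" and S: "S \<subseteq> T"
  shows "(\<Sum>v\<in>A. card (N v)) \<le> (card T - card S) * card A + (\<Sum>t\<in>S. card {v \<in> A. t \<in> N v})"
proof -
  have finS: "finite S" using S fin finite_subset by blast
  have "card (N v) \<le> (card T - card S) + (\<Sum>t\<in>S. of_bool (t \<in> N v))" if "v \<in> A" for v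
  proof -
    have "card (N v) \<le> card ((T - S) \<union> (S \<inter> N v))"
      using N[OF that] fin finS by (intro card_mono) auto
    also have "\<dots> \<le> card (T - S) + card (S \<inter> N v)" by (rule card_Un_le)
    also have "card (T - S) = card T - card S" using S finS by (intro card_Diff_subset)
    finally show ?thesis using finS by simp
  qed
  then have "(\<Sum>v\<in>A. card (N v)) \<le> (\<Sum>v\<in>A. (card T - card S) + (\<Sum>t\<in>S. of_bool (t \<in> N v)))"
    by (intro sum_mono)
  also have "\<dots> = (card T - card S) * card A + (\<Sum>t\<in>S. \<Sum>v\<in>A. of_bool (t \<in> N v))"
    unfolding sum.distrib by (subst sum.swap) simp
  also have "(\<Sum>t\<in>S. \<Sum>v\<in>A. of_bool (t \<in> N v)) = (\<Sum>t\<in>S. card {v \<in> A. t \<in> N v})"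
    using fin(1) by (intro sum.cong) (simp_all add: Int_def)
  finally show ?thesis .
qed

text \<open>Connected without a cut vertex; a single vertex and a single edge qualify. Admitting an
  empty boundary makes connectedness part of the notion.\<close>

definition noncut :: "'a set set \<Rightarrow> 'a set \<Rightarrow> bool" where
  "noncut E H \<longleftrightarrow> (\<forall>W x. W \<subseteq> H \<and> W \<noteq> {} \<and> nbrs E H W \<subseteq> {x} \<longrightarrow> H - {x} \<subseteq> W)"

definition linked :: "'a set set \<Rightarrow> 'a set \<Rightarrow> bool" where
  "linked E H \<longleftrightarrow> (\<forall>W. W \<subseteq> H \<and> W \<noteq> {} \<and> nbrs E H W = {} \<longrightarrow> W = H)"

lemma linked_path:
  assumes "finite H" "linked E H" "u \<in> H" "v \<in> H"
  obtains p where "graph_path H E p" "hd p = u" "last p = v"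
proof -
  have "D \<inter> {v} \<noteq> {}" if "D \<subseteq> H" "u \<in> D" "nbrs E H D = {}" for D
  proof -
    have "D = H" using assms(2) that unfolding linked_def by blast
    then show ?thesis using assms(4) by simp
  qed
  then obtain p where "graph_path H E p" "hd p = u" "last p \<in> {v}"
    using graph_path_to[of H u E "{v}"] assms(1,3) by blast
  then show thesis using that by blast
qed

lemma noncut_linked:
  assumes "noncut E H"
  shows "linked E H"
  unfolding linked_def
proof (intro allI impI, elim conjE)
  fix W assume W: "W \<subseteq> H" "W \<noteq> {}" "nbrs E H W = {}"
  have cut: "H - {x} \<subseteq> W" for x
    using assms W unfolding noncut_def by auto
  obtain y where "y \<in> W" using W by auto
  then show "W = H" using cut[of y] W(1) by blast
qed

text \<open>A set with empty boundary contains both \<open>u\<close> and \<open>u'\<close>. A set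
  with boundary \<open>{x}\<close> misses only \<open>x\<close>, hence contains at least one of
  them. This is where two different end vertices are required of a gap.\<close>

lemma noncut_two:
  assumes "noncut E H" "finite H" "u \<in> P" "u' \<in> Q" "u \<noteq> u'" "P \<subseteq> H" "Q \<subseteq> H"
    and W: "W \<subseteq> H" "W \<noteq> {}"
  shows "2 \<le> card (nbrs E H W) + of_bool (W \<inter> P \<noteq> {}) + of_bool (W \<inter> Q \<noteq> {})"
proof -
  have cut: "H - {x} \<subseteq> W" if "nbrs E H W \<subseteq> {x}" for x
    using assms(1) W that unfolding noncut_def by blast
  have fin: "finite (nbrs E H W)"
    using assms(2) nbrs_subset by (metis finite_Diff finite_subset)
  consider "nbrs E H W = {}" | x where "nbrs E H W = {x}" | "card (nbrs E H W) \<ge> 2"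
    using fin by (metis One_nat_def card_1_singletonE card_eq_0_iff less_2_cases not_le)
  then show ?thesis
  proof cases
    case 1
    then have "H - {u} \<subseteq> W" "H - {u'} \<subseteq> W" using cut by auto
    then have "W \<inter> P \<noteq> {}" "W \<inter> Q \<noteq> {}" using assms(3-7) by blast+
    then show ?thesis by simp
  next
    case (2 x)
    then have "H - {x} \<subseteq> W" using cut by simp
    then have "W \<inter> P \<noteq> {} \<or> W \<inter> Q \<noteq> {}" using assms(3-7) by blast
    then show ?thesis using 2 by auto
  qed simp
qed

text \<open>Any two attachments of a connected \<open>H\<close> are joined by a path through
  \<open>H\<close>, so \<open>gapped\<close> keeps them at distance at least 2. A gap bridged by
  \<open>p\<close> has \<open>t' - t \<ge> length p + 1\<close>, and the packing argument of
  \<open>spaced_card_gap\<close> does the rest.\<close>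

lemma gapped_gap:
  assumes "gapped E k Y c H N" "linked E H" "H \<noteq> {}"
  defines "T \<equiv> \<Union>(N ` H)"
  shows "2 * card T \<le> c"
    and "\<lbrakk>(t, t') \<in> gaps T Y \<or> (t', t) \<in> gaps T Y; graph_path H E p; t \<in> N (hd p); t' \<in> N (last p)\<rbrakk>
      \<Longrightarrow> 2 * card T + length p \<le> c + 1"
proof -
  have finH: "finite H" and finN: "\<And>v. v \<in> H \<Longrightarrow> finite (N v)"
    and G: "\<And>p t t'. graph_path H E p \<Longrightarrow> t \<in> N (hd p) \<Longrightarrow> t' \<in> N (last p) \<Longrightarrow> t < t' \<Longrightarrow>
      Y \<inter> {t<..<t'} = {} \<Longrightarrow> t + length p + 1 \<le> t'"
    and spread': "\<And>p t t'. graph_path H E p \<Longrightarrow> t \<in> N (hd p) \<Longrightarrow> t' \<in> N (last p) \<Longrightarrow> t + 2 \<le> c + t'"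
    using assms(1) unfolding gapped_def by blast+
  have spread: "x + 2 \<le> c + y" if xy: "x \<in> T" "y \<in> T" for x y
  proof -
    obtain u v where uv: "u \<in> H" "x \<in> N u" "v \<in> H" "y \<in> N v"
      using xy unfolding T_def by blast
    obtain p where "graph_path H E p" "hd p = u" "last p = v"
      using linked_path[OF finH assms(2) uv(1,3)] .
    then show ?thesis using uv by (intro spread'[of p]) auto
  qed
  have finT: "finite T" using finH finN by (auto simp: T_def)
  have spaced: "x + 2 \<le> y" if xy: "x \<in> T" "y \<in> T" "x < y" for x y
  proof (rule ccontr)
    assume "\<not> x + 2 \<le> y"
    \<comment> \<open>Nothing lies strictly between \<open>x\<close> and \<open>Suc x\<close>, so
      \<open>Y\<close> cannot block the detour.\<close>
    then have y: "y = Suc x" using xy by simp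
    obtain u v where uv: "u \<in> H" "x \<in> N u" "v \<in> H" "y \<in> N v"
      using xy unfolding T_def by blast
    obtain p where p: "graph_path H E p" "hd p = u" "last p = v"
      using linked_path[OF finH assms(2) uv(1,3)] .
    then have "x + length p + 1 \<le> y" using uv y by (intro G) auto
    then show False using y p(1) by (auto simp: graph_path_def)
  qed
  show "2 * card T \<le> c" by (rule spaced_card[OF finT spaced spread])
  have *: "2 * card T + length p \<le> c + 1"
    if "(t, t') \<in> gaps T Y" "graph_path H E p" "t \<in> N (hd p)" "t' \<in> N (last p)" for t t' p
  proof -
    have g: "t \<in> T" "t' \<in> T" "t < t'" "T \<inter> {t<..<t'} = {}" "Y \<inter> {t<..<t'} = {}"
      using that(1) unfolding gaps_def by auto
    have "2 * card T + (t' - t) \<le> c + 2"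
      using g by (intro spaced_card_gap[OF finT spaced spread]) auto
    moreover have "t + length p + 1 \<le> t'" using that g by (intro G)
    ultimately show ?thesis by simp
  qed
  show "2 * card T + length p \<le> c + 1"
    if "(t, t') \<in> gaps T Y \<or> (t', t) \<in> gaps T Y" "graph_path H E p" "t \<in> N (hd p)" "t' \<in> N (last p)"
    using that(1)
  proof
    assume "(t', t) \<in> gaps T Y"
    moreover have "p \<noteq> []" using that(2) by (auto simp: graph_path_def)
    ultimately show ?thesis
      using *[of t' t "rev p"] that(2-4) by (simp add: graph_path_rev hd_rev last_rev)
  qed (rule *[OF _ that(2-4)])
qed

text \<open>A gap whose ends are attached to different vertices makes the path theorem applicable to
  \<open>H\<close> itself, the two ends of the gap acting as the virtual vertices. The gap limits
  the length of all paths concerned.\<close>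

lemma gap_bound_noncut:
  fixes N :: "'a \<Rightarrow> nat set"
  assumes loopless: "\<And>v. {v} \<notin> E"
    and IH: "\<And>H' k Y c (N :: 'a \<Rightarrow> nat set). H' \<subset> H \<Longrightarrow> gapped E k Y c H' N \<Longrightarrow> gap_bound E c H' N"
    and g: "gapped E k Y c H N" and nc: "noncut E H" and ne: "H \<noteq> {}"
  shows "gap_bound E c H N"
proof -
  define T where "T = \<Union>(N ` H)"
  have finH: "finite H" and finN: "\<And>v. v \<in> H \<Longrightarrow> finite (N v)" and Y: "finite Y" "card Y + 2 \<le> k"
    and K: "\<And>W. W \<subseteq> H \<Longrightarrow> W \<noteq> {} \<Longrightarrow> k \<le> card (nbrs E H W) + card (\<Union>(N ` W))"
    using g unfolding gapped_def by blast+
  have finT: "finite T" using finH finN by (auto simp: T_def)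
  have NT: "\<And>v. v \<in> H \<Longrightarrow> N v \<subseteq> T" by (auto simp: T_def)
  note gap = gapped_gap[OF g noncut_linked[OF nc] ne, folded T_def]
  have "card T \<le> card (gaps T Y) + card Y + 1" by (rule card_gaps_ge[OF finT Y(1)])
  then have many: "card T + 1 \<le> card (gaps T Y) + k" using Y(2) by simp
  have "gaps T Y \<subseteq> T \<times> T" by (auto simp: gaps_def)
  from gap_dichotomy[OF finH finN order_refl this[unfolded T_def] K many[unfolded T_def], folded T_def]
  consider t t' u u' where "(t, t') \<in> gaps T Y" "u \<in> H" "u' \<in> H" "u \<noteq> u'" "t \<in> N u" "t' \<in> N u'"
    | "\<forall>v\<in>H. card (N v) + 2 * (card H - 1) \<le> card T" by blast
  then show ?thesis
  proof cases
    case (1 t t' u u')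
    define P Q where "P = {v \<in> H. t \<in> N v}" and "Q = {v \<in> H. t' \<in> N v}"
    have tt: "t \<in> T" "t' \<in> T" "t \<noteq> t'" using 1(1) by (auto simp: gaps_def)
    have PQ: "P \<subseteq> H" "Q \<subseteq> H" "u \<in> P" "u' \<in> Q" using 1 by (auto simp: P_def Q_def)
    have short: "length p \<le> c + 1 - 2 * card T"
      if "graph_path H E p" "hd p \<in> P" "last p \<in> Q" for p
      using gap(2)[of t t' p] that 1(1) by (simp add: P_def Q_def)
    have "card (arcs E H H) + 2 * card P + 2 * card Q \<le> (c + 1 - 2 * card T + 3) * card H"
      by (rule long_path_bound[OF loopless IH finH PQ(1,2) noncut_two[OF nc finH PQ(3,4) 1(4) PQ(1,2)] short])
    moreover have "(\<Sum>v\<in>H. card (N v)) \<le> (card T - 2) * card H + (card P + card Q)"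
      using sum_card_le[where N = N and S = "{t, t'}", OF finH finT NT] tt by (simp add: P_def Q_def numeral_2_eq_2)
    ultimately have "card (arcs E H H) + 2 * (\<Sum>v\<in>H. card (N v)) \<le>
        (c + 1 - 2 * card T + 3) * card H + 2 * ((card T - 2) * card H)" by linarith
    also have "\<dots> = (c + 1 - 2 * card T + 3 + 2 * (card T - 2)) * card H" by (simp add: algebra_simps)
    \<comment> \<open>The bound on the paths makes the sum exactly \<open>c\<close>. No subtraction
      is truncated because \<open>2 * card T \<le> c\<close> and
      \<open>2 \<le> card T\<close>.\<close>
    also have "c + 1 - 2 * card T + 3 + 2 * (card T - 2) = c"
      using gap(1) card_mono[OF finT, of "{t, t'}"] tt by simp
    finally show ?thesis by (simp add: gap_bound_def)
  next
    case 2
    \<comment> \<open>Every vertex misses at least \<open>2 * (card H - 1)\<close> positions, which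
      outweighs its at most \<open>card H - 1\<close> neighbours in \<open>H\<close>, so that
      \<open>2 * card T \<le> c\<close> suffices.\<close>
    have "(\<Sum>v\<in>H. card (N v)) \<le> (\<Sum>v\<in>H. card T - 2 * (card H - 1))"
      using 2 by (intro sum_mono) (meson Nat.le_diff_conv2 add_leD2)
    then have "(\<Sum>v\<in>H. card (N v)) \<le> card H * (card T - 2 * (card H - 1))" by simp
    moreover have "card (arcs E H H) \<le> card H * (card H - 1)"
      by (rule card_arcs_self_le[OF finH loopless])
    ultimately have "card (arcs E H H) + 2 * (\<Sum>v\<in>H. card (N v)) \<le>
      card H * (card H - 1) + 2 * (card H * (card T - 2 * (card H - 1)))" by linarith
    also have "\<dots> = card H * (card H - 1 + 2 * (card T - 2 * (card H - 1)))" 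
      by (metis add_mult_distrib2 mult.left_commute)
    also have "\<dots> \<le> card H * c"
    proof (intro mult_le_mono2)
      have "2 * (card H - 1) \<le> card T" using 2 ne by force
      then show "card H - 1 + 2 * (card T - 2 * (card H - 1)) \<le> c" using gap(1) by linarith
    qed
    finally show ?thesis by (simp add: gap_bound_def mult.commute)
  qed
qed

subsection \<open>Contracting an end part\<close>

text \<open>\<open>A\<close> has no neighbours in \<open>H\<close> outside
  \<open>insert w A\<close>, so a nonempty part of \<open>A\<close> with at most one neighbour there
  is itself an end part, and by minimality it is all of \<open>A\<close>. For a set containing
  \<open>w\<close> the same is applied to what it misses.\<close>

lemma noncut_min_cut:
  assumes linked: "linked E H" and A: "A \<subseteq> H" "nbrs E H A = {w}" "\<not> H - {w} \<subseteq> A"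
    and fin: "finite H"
    and minimal: "\<And>W x. W \<subseteq> H \<Longrightarrow> W \<noteq> {} \<Longrightarrow> nbrs E H W = {x} \<Longrightarrow> \<not> H - {x} \<subseteq> W \<Longrightarrow> card A \<le> card W"
  shows "noncut E (insert w A)"
proof -
  define B where "B = insert w A"
  have w: "w \<in> H" "w \<notin> A" using A(2) by (auto simp: nbrs_def)
  obtain d where d: "d \<in> H" "d \<notin> B" using A(3) by (auto simp: B_def)
  have A_nbr: "x \<in> B" if "a \<in> A" "{a, x} \<in> E" "x \<in> H" for a x
  proof (rule ccontr)
    assume "x \<notin> B"
    then have "x \<in> nbrs E H A" using that by (auto simp: nbrs_def B_def)
    then show False using A(2) \<open>x \<notin> B\<close> by (simp add: B_def)
  qed
  have key: "W = A \<and> x = w" if W: "W \<subseteq> A" "W \<noteq> {}" "nbrs E B W \<subseteq> {x}" for W x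
  proof -
    have sub: "nbrs E H W \<subseteq> nbrs E B W" using A_nbr W(1) by (auto simp: nbrs_def)
    have "W \<noteq> H" "W \<subseteq> H" using W(1) w A(1) by auto
    then have ne: "nbrs E H W \<noteq> {}" using linked W(2) by (auto simp: linked_def)
    then have eq: "nbrs E H W = {x}" using sub W(3) by auto
    then have "x \<in> B" using sub by (auto simp: nbrs_def)
    then have "\<not> H - {x} \<subseteq> W" using d W(1) by (auto simp: B_def)
    then have "card A \<le> card W" using minimal[OF \<open>W \<subseteq> H\<close> W(2) eq] by simp
    then have "W = A" using W(1) card_seteq[of A W] finite_subset[OF A(1) fin] by simp
    then show ?thesis using eq A(2) by simp
  qed
  have "B - {x} \<subseteq> W" if W: "W \<subseteq> B" "W \<noteq> {}" "nbrs E B W \<subseteq> {x}" for W x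
  proof (cases "w \<in> W")
    case False
    then have "W \<subseteq> A" using W(1) by (auto simp: B_def)
    then show ?thesis using key W(2,3) by (auto simp: B_def)
  next
    case True
    show ?thesis
    proof (rule ccontr)
      \<comment> \<open>\<open>Z\<close> has no neighbour but \<open>x\<close>, and it avoids
        \<open>w\<close>. So \<open>key\<close> makes it all of \<open>A\<close>, although
        \<open>w\<close> belongs to \<open>W\<close> and has a neighbour in
        \<open>A\<close>.\<close>
      define Z where "Z = B - W - {x}"
      assume "\<not> B - {x} \<subseteq> W"
      then have "Z \<noteq> {}" "Z \<subseteq> A" using True by (auto simp: Z_def B_def)
      moreover have nonadj: "{z, y} \<notin> E" if "z \<in> Z" "y \<in> W" for z y
      proof
        assume "{z, y} \<in> E"
        then have "z \<in> nbrs E B W"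
          using that by (auto simp: nbrs_def Z_def insert_commute)
        then show False using W(3) that by (auto simp: Z_def)
      qed
      then have "nbrs E B Z \<subseteq> {x}" by (auto simp: nbrs_def Z_def)
      ultimately have "Z = A" "x = w" using key by auto
      have "w \<in> nbrs E H A" using A(2) by simp
      then obtain a where "a \<in> A" "{a, w} \<in> E" by (auto simp: nbrs_def)
      then show False using nonadj[of a w] True \<open>Z = A\<close> by simp
    qed
  qed
  then show ?thesis unfolding noncut_def B_def by blast
qed

text \<open>Undoes the contraction of \<open>A\<close> on a path starting at \<open>w\<close>: a
  path from \<open>a\<close> to \<open>w\<close> inside \<open>insert w A\<close> is put in front,
  and the path only becomes longer.\<close>

lemma extend_path:
  assumes noncut: "noncut E (insert w A)" and fin: "finite A" and w: "w \<notin> A" and "a \<in> A" "A \<inter> H' = {}"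
    and p: "graph_path H' E p" "hd p = w"
  obtains p' where "graph_path (A \<union> H') E p'" "hd p' = a" "last p' = last p" "length p < length p'"
proof -
  obtain r where r: "graph_path (insert w A) E r" "hd r = a" "last r = w"
    using linked_path[OF _ noncut_linked[OF noncut], of a w] fin \<open>a \<in> A\<close> by auto
  define s where "s = butlast r"
  have "r \<noteq> []" using r by (auto simp: graph_path_def)
  then have rs: "r = s @ [w]" using r(3) by (metis append_butlast_last_id s_def)
  have sne: "s \<noteq> []" using rs r(2) w \<open>a \<in> A\<close> by (cases s) auto
  have s: "graph_path A E s" "hd s = a" "{last s, w} \<in> E"
    using r sne w unfolding rs
    by (auto simp: graph_path_append) (auto simp: graph_path_def)
  have pne: "p \<noteq> []" using p by (auto simp: graph_path_def)
  have "set s \<inter> set p = {}" using s(1) p(1) \<open>A \<inter> H' = {}\<close> by (auto simp: graph_path_def)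
  then have "graph_path (A \<union> H') E (s @ p)"
    using s p sne pne graph_path_mono[of A E s "A \<union> H'"] graph_path_mono[of H' E p "A \<union> H'"]
    by (simp add: graph_path_append)
  then show thesis using that[of "s @ p"] s(2) sne pne by simp
qed

text \<open>A detour through the contracted piece lifts to one in \<open>H\<close> that is at least
  as long, since an attachment inherited by \<open>w\<close> is reached through \<open>A\<close>. In
  the connectivity condition, a set containing \<open>w\<close> stands for its union with
  \<open>A\<close>.\<close>

lemma gapped_contract:
  fixes N :: "'a \<Rightarrow> nat set"
  assumes g: "gapped E k Y c H N" and linked: "linked E H"
    and A: "A \<subseteq> H" "nbrs E H A = {w}" and noncut: "noncut E (insert w A)"
  shows "gapped E k Y c (H - A) (N(w := N w \<union> \<Union>(N ` A)))"
proof -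
  define H' where "H' = H - A"
  define N' where "N' = N(w := N w \<union> \<Union>(N ` A))"
  have finH: "finite H" and finN: "\<And>v. v \<in> H \<Longrightarrow> finite (N v)" and Y: "finite Y" "card Y + 2 \<le> k"
    and K: "\<And>W. W \<subseteq> H \<Longrightarrow> W \<noteq> {} \<Longrightarrow> k \<le> card (nbrs E H W) + card (\<Union>(N ` W))"
    and G: "\<And>p t t'. graph_path H E p \<Longrightarrow> t \<in> N (hd p) \<Longrightarrow> t' \<in> N (last p) \<Longrightarrow> t < t' \<Longrightarrow>
      Y \<inter> {t<..<t'} = {} \<Longrightarrow> t + length p + 1 \<le> t'"
    and spread: "\<And>p t t'. graph_path H E p \<Longrightarrow> t \<in> N (hd p) \<Longrightarrow> t' \<in> N (last p) \<Longrightarrow> t + 2 \<le> c + t'"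
    using g unfolding gapped_def by blast+
  have w: "w \<in> H" "w \<notin> A" using A(2) by (auto simp: nbrs_def)
  have nonadj: "{v, a} \<notin> E" if "a \<in> A" "v \<in> H - A" "v \<noteq> w" for a v
  proof
    assume "{v, a} \<in> E"
    then have "v \<in> nbrs E H A" using that by (auto simp: nbrs_def insert_commute)
    then show False using A(2) that by simp
  qed
  have ext: "\<exists>p'. graph_path H E p' \<and> t \<in> N (hd p') \<and> last p' = last p \<and> length p \<le> length p'"
    if p: "graph_path H E p" "set p \<inter> A = {}" "t \<in> N' (hd p)" for p t
  proof (cases "t \<in> N (hd p)")
    case False
    then obtain a where a: "hd p = w" "a \<in> A" "t \<in> N a"
      using p(3) by (auto simp: N'_def split: if_splits)
    have "graph_path H' E p" using p(1,2) by (auto simp: graph_path_def H'_def)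
    then obtain p' where "graph_path (A \<union> H') E p'" "hd p' = a" "last p' = last p" "length p < length p'"
      using extend_path[OF noncut finite_subset[OF A(1) finH] w(2) a(2), of H' p] a(1)
      by (auto simp: H'_def)
    moreover have "A \<union> H' = H" using A(1) by (auto simp: H'_def)
    ultimately show ?thesis using a(3) by (intro exI[of _ p']) simp
  qed (use p in auto)
  have "\<exists>p'. graph_path H E p' \<and> t \<in> N (hd p') \<and> t' \<in> N (last p') \<and> length p \<le> length p'"
    if p: "graph_path H' E p" "t \<in> N' (hd p)" "t' \<in> N' (last p)" for p t t'
  proof (cases "hd p = last p")
    \<comment> \<open>The path is a single vertex. If it is \<open>w\<close>, its two attachments
      may come from different vertices of \<open>A\<close>; any path of \<open>H\<close> between two
      such vertices is long enough.\<close>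
    case True
    have pne: "p \<noteq> []" "distinct p" "set p \<subseteq> H'" using p(1) by (auto simp: graph_path_def)
    then have "length p = 1" using True
      by (cases p) (auto split: if_splits)
    have "\<exists>u\<in>H. x \<in> N u" if "x \<in> N' (hd p)" for x
    proof -
      have "hd p \<in> H'" using pne hd_in_set[OF pne(1)] by blast
      then show ?thesis using that w(1) A(1) by (auto simp: N'_def H'_def split: if_splits)
    qed
    then obtain u u' where u: "u \<in> H" "t \<in> N u" "u' \<in> H" "t' \<in> N u'" using p(2,3) True by metis
    obtain r where r: "graph_path H E r" "hd r = u" "last r = u'"
      using linked_path[OF finH linked u(1,3)] .
    then have "length r \<ge> 1" by (cases r) (auto simp: graph_path_def)
    then show ?thesis using r u \<open>length p = 1\<close> by auto
  next
    case False
    have pH: "graph_path H E p" "set p \<inter> A = {}" and pne: "p \<noteq> []"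
      using p(1) by (auto simp: graph_path_def H'_def)
    show ?thesis
    proof (cases "t' \<in> N (last p)")
      case True
      then show ?thesis using ext[OF pH p(2)] by metis
    next
      case t': False
      then have "last p = w" using p(3) by (auto simp: N'_def split: if_splits)
      then have "t \<in> N (hd p)" using p(2) False by (auto simp: N'_def split: if_splits)
      moreover obtain q where q: "graph_path H E q" "t' \<in> N (hd q)" "last q = last (rev p)" "length p \<le> length q"
        using ext[of "rev p" t'] pH p(3) pne by (auto simp: graph_path_rev hd_rev)
      moreover have "q \<noteq> []" using q(1) by (auto simp: graph_path_def)
      ultimately show ?thesis
        using pne by (intro exI[of _ "rev q"]) (auto simp: graph_path_rev hd_rev last_rev)
    qed
  qed
  note lift = this
  have "gapped E k Y c H' N'"
    unfolding gapped_def
  proof (intro conjI allI impI ballI; (elim conjE)?)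
    fix W assume W: "W \<subseteq> H'" "W \<noteq> {}"
    show "k \<le> card (nbrs E H' W) + card (\<Union>(N' ` W))"
    proof (cases "w \<in> W")
      case False
      then have "nbrs E H W = nbrs E H' W"
        using nonadj W(1) by (auto simp: nbrs_def H'_def)
      moreover have "\<Union>(N' ` W) = \<Union>(N ` W)" using False by (auto simp: N'_def)
      moreover have "W \<subseteq> H" using W(1) by (auto simp: H'_def)
      ultimately show ?thesis using K[of W] W(2) by simp
    next
      case True
      have "nbrs E H (W \<union> A) = nbrs E H' W"
      proof -
        have "v \<notin> nbrs E H A" if "v \<in> H - (W \<union> A)" for v using A(2) that True by auto
        then show ?thesis by (auto simp: nbrs_def H'_def)
      qed
      moreover have "\<Union>(N' ` W) = \<Union>(N ` (W \<union> A))"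
        using True W(1) by (auto simp: N'_def H'_def split: if_splits)
      moreover have "W \<union> A \<subseteq> H" using W(1) A(1) by (auto simp: H'_def)
      ultimately show ?thesis using K[of "W \<union> A"] W(2) by simp
    qed
  next
    fix p t t' assume *: "graph_path H' E p" "t \<in> N' (hd p)" "t' \<in> N' (last p)" "t < t'" "Y \<inter> {t<..<t'} = {}"
    obtain p' where "graph_path H E p'" "t \<in> N (hd p')" "t' \<in> N (last p')" "length p \<le> length p'"
      using lift[OF *(1-3)] by blast
    then show "t + length p + 1 \<le> t'" using G[of p' t t'] *(4,5) by simp
  next
    fix p t t' assume *: "graph_path H' E p" "t \<in> N' (hd p)" "t' \<in> N' (last p)"
    show "t + 2 \<le> c + t'" using lift[OF *] spread by blast
  next
    show "finite H'" using finH by (simp add: H'_def)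
  next
    fix v assume "v \<in> H'"
    then show "finite (N' v)" using finN finite_subset[OF A(1) finH] A(1) w(1) by (auto simp: N'_def H'_def)
  qed (use Y in auto)
  then show ?thesis by (simp add: H'_def N'_def)
qed

text \<open>Here \<open>w\<close> takes the place of the second virtual vertex: a set meets
  \<open>Q\<close> exactly if \<open>w\<close> is in its boundary in
  \<open>insert w A\<close>.\<close>

lemma noncut_two_end:
  assumes noncut: "noncut E (insert w A)" and fin: "finite A" and w: "w \<notin> A"
    and P: "P \<subseteq> A" "P \<noteq> {}" and W: "W \<subseteq> A" "W \<noteq> {}"
  defines "Q \<equiv> {v \<in> A. {v, w} \<in> E}"
  shows "2 \<le> card (nbrs E A W) + of_bool (W \<inter> P \<noteq> {}) + of_bool (W \<inter> Q \<noteq> {})"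
proof -
  obtain u where u: "u \<in> P" using P(2) by blast
  have "2 \<le> card (nbrs E (insert w A) W) + of_bool (W \<inter> P \<noteq> {}) + of_bool (W \<inter> {w} \<noteq> {})"
  proof (rule noncut_two[OF noncut _ u])
    show "u \<noteq> w" "P \<subseteq> insert w A" "W \<subseteq> insert w A" using u P(1) W(1) w by auto
  qed (use fin W(2) in auto)
  moreover have "W \<inter> {w} = {}" using W(1) w by auto
  moreover have "card (nbrs E (insert w A) W) = card (nbrs E A W) + of_bool (W \<inter> Q \<noteq> {})"
  proof -
    have "nbrs E (insert w A) W = nbrs E A W \<union> (if W \<inter> Q \<noteq> {} then {w} else {})"
      using W(1) w by (auto simp: nbrs_def Q_def)
    moreover have "w \<notin> nbrs E A W" "finite (nbrs E A W)"
      using w fin finite_subset[OF nbrs_subset] by (auto simp: nbrs_def)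
    ultimately show ?thesis by simp
  qed
  ultimately show ?thesis by simp
qed

text \<open>The edges to \<open>w\<close> are charged to the end part, so that this bound and the
  one for the contracted rest add up to the bound for \<open>H\<close>. A gap leading from
  \<open>T1\<close> to attachments of the other side limits the paths in \<open>A\<close> towards
  \<open>w\<close>. If there is none, enough gaps lie among attachments of \<open>A\<close> alone to
  apply \<open>gap_dichotomy\<close> to \<open>A\<close>.\<close>

lemma end_part_bound:
  fixes N :: "'a \<Rightarrow> nat set"
  assumes loopless: "\<And>v. {v} \<notin> E"
    and IH: "\<And>H' k Y c (N :: 'a \<Rightarrow> nat set). H' \<subset> H \<Longrightarrow> gapped E k Y c H' N \<Longrightarrow> gap_bound E c H' N"
    and g: "gapped E k Y c H N" and linked: "linked E H"
    and A: "A \<subseteq> H" "nbrs E H A = {w}" "\<not> H - {w} \<subseteq> A" "A \<noteq> {}" and noncut: "noncut E (insert w A)"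
  defines "Q \<equiv> {v \<in> A. {v, w} \<in> E}"
  shows "card (arcs E A A) + 2 * card Q + 2 * (\<Sum>v\<in>A. card (N v)) \<le> c * card A"
proof -
  define D where "D = H - insert w A"
  define T T1 T2 T3 where "T = \<Union>(N ` H)" and "T1 = \<Union>(N ` A)" and "T2 = \<Union>(N ` (H - A))" and "T3 = \<Union>(N ` D)"
  have finH: "finite H" and finN: "\<And>v. v \<in> H \<Longrightarrow> finite (N v)" and Y: "finite Y" "card Y + 2 \<le> k"
    and K: "\<And>W. W \<subseteq> H \<Longrightarrow> W \<noteq> {} \<Longrightarrow> k \<le> card (nbrs E H W) + card (\<Union>(N ` W))"
    using g unfolding gapped_def by blast+
  have w: "w \<in> H" "w \<notin> A" using A(2) by (auto simp: nbrs_def)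
  have finA: "finite A" using finite_subset[OF A(1) finH] .
  have finT: "finite T" using finH finN by (auto simp: T_def)
  have TT: "T1 \<subseteq> T" "T2 \<subseteq> T" "T3 \<subseteq> T2" "T = T1 \<union> T2"
    using A(1) w by (auto simp: T_def T1_def T2_def T3_def D_def)
  have fins: "finite T1" "finite T2" "finite T3" using TT finT finite_subset by blast+
  have NT1: "\<And>v. v \<in> A \<Longrightarrow> N v \<subseteq> T1" by (auto simp: T1_def)
  have D: "D \<noteq> {}" "D \<subseteq> H" using A(3) by (auto simp: D_def)
  have nonadj: "{v, a} \<notin> E" if "a \<in> A" "v \<in> D" for a v
  proof
    assume "{v, a} \<in> E"
    then have "v \<in> nbrs E H A" using that by (auto simp: nbrs_def D_def insert_commute)
    then show False using A(2) that by (simp add: D_def)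
  qed
  have A_nbr: "x \<in> A \<or> x = w" if "a \<in> A" "{a, x} \<in> E" "x \<in> H" for a x
    using nonadj[of a x] that by (auto simp: D_def insert_commute)
  have "nbrs E H D \<subseteq> {w}" using nonadj by (auto simp: nbrs_def D_def)
  then have "card (nbrs E H D) \<le> 1" using card_mono[of "{w}"] by fastforce
  \<comment> \<open>\<open>w\<close> is the only possible neighbour of \<open>D\<close>, and
    likewise of \<open>A\<close>, so each of them has at least \<open>k - 1\<close>
    attachments.\<close>
  then have kT3: "k \<le> card T3 + 1" using K[OF D(2,1)] by (simp add: T3_def)
  have kT1: "k \<le> card T1 + 1" using K[OF A(1,4)] A(2) by (simp add: T1_def)
  have kT: "k \<le> card T" using K[of H] w(1) by (auto simp: T_def nbrs_def)
  have Hne: "H \<noteq> {}" using w by auto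
  note gap = gapped_gap[OF g linked Hne, folded T_def]
  define F where "F = gaps T Y"
  have finF: "finite F" unfolding F_def by (rule finite_gaps[OF finT])
  have F: "t \<in> T" "t' \<in> T" "t \<noteq> t'" if "(t, t') \<in> F" for t t' using that by (auto simp: F_def gaps_def)
  have many: "card T + 1 \<le> card F + k"
    using card_gaps_ge[OF finT Y(1)] Y(2) by (simp add: F_def)
  have sum1: "(\<Sum>v\<in>A. card (N v)) \<le> (card T1 - 1) * card A + card {v \<in> A. t \<in> N v}" if "t \<in> T1" for t
    using sum_card_le[where N = N and S = "{t}", OF finA fins(1) NT1] that by simp
  \<comment> \<open>The virtual vertices are the position \<open>t\<close> and \<open>w\<close>
    itself, so the path theorem already accounts for \<open>Q\<close>. The
    \<open>card T1 - 1\<close> other positions contribute at most \<open>2 * card A\<close>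
    each.\<close>
  have exit: ?thesis if q: "q + 3 + 2 * (card T1 - 1) \<le> c" and t: "t \<in> T1"
      and short: "\<And>p. graph_path A E p \<Longrightarrow> t \<in> N (hd p) \<Longrightarrow> {last p, w} \<in> E \<Longrightarrow> length p \<le> q" for q t
  proof -
    define P where "P = {v \<in> A. t \<in> N v}"
    have P: "P \<subseteq> A" "P \<noteq> {}" using t by (auto simp: P_def T1_def)
    have "card (arcs E A A) + 2 * card P + 2 * card Q \<le> (q + 3) * card A"
    proof (rule long_path_bound[OF loopless IH finA P(1)])
      show "Q \<subseteq> A" by (auto simp: Q_def)
      show "2 \<le> card (nbrs E A W) + of_bool (W \<inter> P \<noteq> {}) + of_bool (W \<inter> Q \<noteq> {})"
        if "W \<subseteq> A" "W \<noteq> {}" for W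
        unfolding Q_def by (rule noncut_two_end[OF noncut finA w(2) P that])
      show "H' \<subset> H" if "H' \<subset> A" for H' using that A(1) by blast
      show "length p \<le> q" if "graph_path A E p" "hd p \<in> P" "last p \<in> Q" for p
        using that by (intro short) (auto simp: P_def Q_def)
    qed
    then have "card (arcs E A A) + 2 * card Q + 2 * (\<Sum>v\<in>A. card (N v)) \<le>
        (q + 3) * card A + 2 * ((card T1 - 1) * card A)"
      using sum1[OF t] unfolding P_def by linarith
    also have "\<dots> = (q + 3 + 2 * (card T1 - 1)) * card A" by (simp only: add_mult_distrib mult.assoc)
    also have "\<dots> \<le> c * card A" using q by (rule mult_le_mono1)
    finally show ?thesis .
  qed
  have prepath: "graph_path H E (p @ r)"
    if "graph_path A E p" "{last p, w} \<in> E" "graph_path (H - A) E r" "hd r = w" for p r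
  proof -
    have "p \<noteq> []" "r \<noteq> []" "set p \<inter> set r = {}" using that by (auto simp: graph_path_def)
    then show ?thesis
      using that graph_path_mono[OF that(1) A(1)] graph_path_mono[OF that(3), of H]
      by (simp add: graph_path_append)
  qed
  consider (far) t t' where "(t, t') \<in> F \<or> (t', t) \<in> F" "t \<in> T1" "t' \<in> T3"
    | (near) t t' where "(t, t') \<in> F \<or> (t', t) \<in> F" "t \<in> T1" "t' \<in> T2" "t' \<notin> T3" "T1 \<noteq> T"
    | (none) "\<And>t t'. (t, t') \<in> F \<or> (t', t) \<in> F \<Longrightarrow> t \<in> T1 \<Longrightarrow> t' \<notin> T3"
        "\<And>t t'. (t, t') \<in> F \<or> (t', t) \<in> F \<Longrightarrow> t \<in> T1 \<Longrightarrow> t' \<in> T2 \<Longrightarrow> T1 = T"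
    by metis
  then show ?thesis
  proof cases
    case far
    \<comment> \<open>The detour continues through \<open>w\<close> to a vertex beyond it. These at
      least two further vertices lower the bound on paths in \<open>A\<close> to
      \<open>c - 1 - 2 * card T\<close>, which suffices even if \<open>T1 = T\<close>.\<close>
    obtain z where z: "z \<in> D" "t' \<in> N z" using far(3) by (auto simp: T3_def)
    have "X \<inter> {z} \<noteq> {}" if X: "X \<subseteq> H - A" "w \<in> X" "nbrs E (H - A) X = {}" for X
    proof -
      have "nbrs E H (X \<union> A) = {}"
      proof -
        have "v \<notin> nbrs E H A" if "v \<in> H - (X \<union> A)" for v using A(2) that X(2) by auto
        then show ?thesis using X(3) by (auto simp: nbrs_def)
      qed
      moreover have "X \<union> A \<subseteq> H" "X \<union> A \<noteq> {}" using X(1) A(1,4) by auto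
      ultimately have "X \<union> A = H" using linked by (simp add: linked_def)
      then show ?thesis using z(1) by (auto simp: D_def)
    qed
    then obtain r where r: "graph_path (H - A) E r" "hd r = w" "last r = z"
      using graph_path_to[of "H - A" w E "{z}"] finH w by (auto simp: D_def)
    have r2: "length r \<ge> 2"
    proof -
      have "w \<noteq> z" using z by (auto simp: D_def)
      then show ?thesis using r by (cases r; cases "tl r") (auto simp: graph_path_def)
    qed
    have len: "2 * card T + length p + 1 \<le> c" if p: "graph_path A E p" "t \<in> N (hd p)" "{last p, w} \<in> E" for p
    proof -
      have ne: "p \<noteq> []" "r \<noteq> []" using p(1) r(1) by (auto simp: graph_path_def)
      have "2 * card T + length (p @ r) \<le> c + 1"
        using gap(2)[of t t' "p @ r"] far(1) prepath[OF p(1,3) r(1,2)] p(2) r(3) z(2) ne by (simp add: F_def)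
      then show ?thesis using r2 by simp
    qed
    obtain a where a: "a \<in> A" "t \<in> N a" using far(2) by (auto simp: T1_def)
    have "X \<inter> Q \<noteq> {}" if X: "X \<subseteq> A" "a \<in> X" "nbrs E A X = {}" for X
    proof
      assume "X \<inter> Q = {}"
      then have "w \<notin> nbrs E H X" using X(1) by (auto simp: nbrs_def Q_def)
      moreover have "nbrs E H X \<subseteq> nbrs E A X \<union> {w}"
        using A_nbr X(1) unfolding nbrs_def by blast
      ultimately have "nbrs E H X = {}" using X(3) by auto
      moreover have "X \<subseteq> H" "X \<noteq> {}" using X(1,2) A(1) by auto
      ultimately have "X = H" using linked by (simp add: linked_def)
      then show False using X(1) w by auto
    qed
    then obtain p0 where "graph_path A E p0" "hd p0 = a" "last p0 \<in> Q"
      using graph_path_to[of A a E Q] finA a by blast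
    then have "2 * card T + length p0 + 1 \<le> c" using a(2) by (intro len) (auto simp: Q_def)
    \<comment> \<open>The existence of one such path keeps the subtraction below from being
      truncated.\<close>
    then have q: "2 * card T + 1 \<le> c" by simp
    show ?thesis
    proof (rule exit[of "c - 1 - 2 * card T" t])
      have "card T1 \<le> card T" by (rule card_mono[OF finT TT(1)])
      moreover have "card T1 \<noteq> 0" using far(2) fins(1) by auto
      ultimately show "c - 1 - 2 * card T + 3 + 2 * (card T1 - 1) \<le> c" using q by linarith
      show "length p \<le> c - 1 - 2 * card T"
        if "graph_path A E p" "t \<in> N (hd p)" "{last p, w} \<in> E" for p using len[OF that] by simp
    qed (rule far(2))
  next
    case near
    \<comment> \<open>The detour gains only \<open>w\<close>, so the bound on paths is weaker by one
      than beyond \<open>w\<close>; \<open>card T1 < card T\<close> makes up for it.\<close>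
    have tw: "t' \<in> N w" using near(3,4) by (auto simp: T2_def T3_def D_def)
    show ?thesis
    proof (rule exit[of "c - 2 * card T" t])
      have "T1 \<subset> T" using TT(1) near(5) by auto
      then have "card T1 < card T" by (rule psubset_card_mono[OF finT])
      moreover have "card T1 \<noteq> 0" using near(2) fins(1) by auto
      ultimately show "c - 2 * card T + 3 + 2 * (card T1 - 1) \<le> c" using gap(1) by linarith
      show "length p \<le> c - 2 * card T" if p: "graph_path A E p" "t \<in> N (hd p)" "{last p, w} \<in> E" for p
      proof -
        have "graph_path (H - A) E [w]" using w by (simp add: graph_path_single)
        from prepath[OF p(1,3) this]
        have "graph_path H E (p @ [w])" by simp
        moreover have "p \<noteq> []" using p(1) by (auto simp: graph_path_def)
        ultimately have "2 * card T + length (p @ [w]) \<le> c + 1"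
          using gap(2)[of t t' "p @ [w]"] near(1) p(2) tw by (simp add: F_def)
        then show ?thesis by simp
      qed
    qed (rule near(2))
  next
    case none
    \<comment> \<open>If \<open>T1 = T\<close>, no gap could touch \<open>T3\<close>, so all gaps
      would lie in \<open>T - T3\<close>, a set of at most \<open>card T - k + 1\<close> elements,
      too small for \<open>many\<close>.\<close>
    have "T1 \<noteq> T"
    proof
      assume eq: "T1 = T"
      have FZ: "F \<subseteq> (T - T3) \<times> (T - T3)"
        using none(1) F unfolding eq by fast
      have cZ: "card (T - T3) = card T - card T3" using TT by (intro card_Diff_subset fins) auto
      have "card T3 \<le> card T" using TT by (intro card_mono finT) auto
      show False
      proof (cases "T - T3 = {}")
        case True
        have "card F = 0" using FZ unfolding True by simp
        then show False using many kT by simp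
      next
        case False
        then have "card F < card (T - T3)"
          using FZ finT by (intro card_gaps_within[of _ F T Y]) (auto simp: F_def)
        then show False using many kT3 cZ \<open>card T3 \<le> card T\<close> by linarith
      qed
    qed
    then have sep: "t' \<notin> T2" if "(t, t') \<in> F \<or> (t', t) \<in> F" "t \<in> T1" for t t' using none(2) that by blast
    define F1 F2 where "F1 = F \<inter> ((T - T2) \<times> (T - T2))" and "F2 = F \<inter> ((T - T1) \<times> (T - T1))"
    have "F \<subseteq> F1 \<union> F2"
    proof
      fix x assume x: "x \<in> F"
      obtain t t' where [simp]: "x = (t, t')" by force
      have t: "t \<in> T1 \<or> t \<in> T2" "t' \<in> T1 \<or> t' \<in> T2" "t \<in> T" "t' \<in> T"
        using F[of t t'] x TT(4) by auto
      show "x \<in> F1 \<union> F2"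
        using x t sep[of t t'] sep[of t' t] unfolding F1_def F2_def by auto
    qed
    then have "card F \<le> card (F1 \<union> F2)" using finF by (intro card_mono) (auto simp: F1_def F2_def)
    also have "\<dots> \<le> card F1 + card F2" by (rule card_Un_le)
    finally have cF: "card F \<le> card F1 + card F2" .
    have "card F2 < card (T - T1)"
      using \<open>T1 \<noteq> T\<close> TT(1) finT by (intro card_gaps_within[of _ F2 T Y]) (auto simp: F2_def F_def)
    moreover have "card (T - T1) = card T - card T1" by (intro card_Diff_subset fins TT)
    moreover have T1T: "card T1 \<le> card T" by (intro card_mono finT TT)
    ultimately have many1: "card T1 + 2 \<le> card F1 + k" using cF many by linarith
    then have "F1 \<noteq> {}" using kT1 by auto
    then have "T - T2 \<noteq> {}" by (auto simp: F1_def)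
    then have "card F1 < card (T - T2)"
      using finT by (intro card_gaps_within[of _ F1 T Y]) (auto simp: F1_def F_def)
    moreover have "card (T - T2) = card T - card T2" by (intro card_Diff_subset fins TT)
    moreover have "card T3 \<le> card T2" by (intro card_mono fins TT)
    moreover have "card T2 \<le> card T" by (intro card_mono finT TT)
    \<comment> \<open>The two positions outside \<open>T1\<close> are the reserve that pays below
      for the edges to \<open>w\<close> and for the additional vertex \<open>w\<close>.\<close>
    ultimately have s2: "card T1 + 2 \<le> card T" using many1 kT3 by linarith
    have F1: "F1 \<subseteq> gaps T Y" "F1 \<subseteq> T1 \<times> T1"
      using TT(4) by (auto simp: F1_def F_def)
    \<comment> \<open>Leaving out \<open>w\<close> costs one neighbour; \<open>many1\<close> has the
      matching surplus.\<close>
    have K1: "k - 1 \<le> card (nbrs E A W) + card (\<Union>(N ` W))" if W: "W \<subseteq> A" "W \<noteq> {}" for W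
    proof -
      have "nbrs E H W \<subseteq> insert w (nbrs E A W)"
        using A_nbr W(1) unfolding nbrs_def by blast
      then have "card (nbrs E H W) \<le> card (insert w (nbrs E A W))"
        using finite_nbrs[OF finA] by (intro card_mono) auto
      also have "\<dots> \<le> card (nbrs E A W) + 1" using finite_nbrs[OF finA] by (simp add: card_insert_if)
      finally show ?thesis using K[OF subset_trans[OF W(1) A(1)] W(2)] by linarith
    qed
    have "card T1 + 1 \<le> card F1 + (k - 1)" using many1 Y(2) by linarith
    from gap_dichotomy[OF finA finN[OF subsetD[OF A(1)]] F1[unfolded T1_def] K1 this[unfolded T1_def], folded T1_def]
    consider (good) t t' u u' where "(t, t') \<in> F1" "u \<in> A" "u' \<in> A" "u \<noteq> u'" "t \<in> N u" "t' \<in> N u'"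
      | (excl) "\<forall>v\<in>A. card (N v) + 2 * (card A - 1) \<le> card T1" by blast
    then show ?thesis
    proof cases
      case good
      define P P' where "P = {v \<in> A. t \<in> N v}" and "P' = {v \<in> A. t' \<in> N v}"
      define B where "B = insert w A"
      \<comment> \<open>Paths are taken in \<open>insert w A\<close>, as \<open>A\<close> alone may
        have cut vertices. The cap \<open>card A + 1\<close> keeps the cost \<open>q + 3\<close> of
        the additional vertex linear in \<open>card A\<close>.\<close>
      define q where "q = min (c + 1 - 2 * card T) (card A + 1)"
      have B: "finite B" "B \<subseteq> H" "B \<subset> H" using finA A(1) w D by (auto simp: B_def D_def)
      have tt: "t \<in> T1" "t' \<in> T1" "t \<noteq> t'" using good(1) F1(2) F[of t t'] by (auto simp: F1_def)
      have PB: "P \<subseteq> B" "P' \<subseteq> B" "u \<in> P" "u' \<in> P'" using good by (auto simp: P_def P'_def B_def)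
      have b1: "card (arcs E B B) + 2 * card P + 2 * card P' \<le> (q + 3) * card B"
      proof (rule long_path_bound[OF loopless IH B(1) PB(1,2)])
        show "2 \<le> card (nbrs E B W) + of_bool (W \<inter> P \<noteq> {}) + of_bool (W \<inter> P' \<noteq> {})"
          if "W \<subseteq> B" "W \<noteq> {}" for W
          using noncut_two[OF noncut[folded B_def] B(1) PB(3,4) good(4) PB(1,2) that] .
        show "H' \<subset> H" if "H' \<subset> B" for H' using that B(2) by blast
        show "length p \<le> q" if p: "graph_path B E p" "hd p \<in> P" "last p \<in> P'" for p
        proof -
          have "length p \<le> card B" by (rule graph_path_length[OF B(1) p(1)])
          moreover have "2 * card T + length p \<le> c + 1"
            using gap(2)[of t t' p] good(1) F1(1) graph_path_mono[OF p(1) B(2)] p(2,3)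
            by (auto simp: P_def P'_def)
          ultimately show ?thesis using w finA by (simp add: q_def B_def)
        qed
      qed
      have b2: "card (arcs E B B) = card (arcs E A A) + 2 * card Q"
      proof -
        have "arcs E A {w} = (\<lambda>v. (v, w)) ` Q" by (auto simp: arcs_def Q_def)
        then have "card (arcs E A {w}) = card Q" by (simp add: card_image inj_on_def)
        moreover have "arcs E {w} {w} = {}" using loopless by (auto simp: arcs_def)
        ultimately show ?thesis using card_arcs_Un[of A "{w}" E] finA w by (simp add: B_def)
      qed
      have b3: "card B = card A + 1" using w finA by (simp add: B_def)
      have b4: "(\<Sum>v\<in>A. card (N v)) \<le> (card T1 - 2) * card A + (card P + card P')"
        using sum_card_le[where N = N and S = "{t, t'}", OF finA fins(1) NT1] tt
        by (simp add: P_def P'_def numeral_2_eq_2)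
      have "card (arcs E A A) + 2 * card Q + 2 * (\<Sum>v\<in>A. card (N v)) \<le>
        (q + 3) * (card A + 1) + 2 * ((card T1 - 2) * card A)"
        using b1 b4 unfolding b2 b3 by linarith
      also have "\<dots> = (q + 3 + 2 * (card T1 - 2)) * card A + (q + 3)"
        by (simp only: add_mult_distrib add_mult_distrib2 mult.assoc mult_1_right)
      also have "\<dots> \<le> (q + 3 + 2 * (card T1 - 2)) * card A + (card A + 4)"
        by (simp add: q_def)
      \<comment> \<open>Two different vertices in \<open>A\<close> give
        \<open>card A + 4 \<le> 3 * card A\<close>, which turns \<open>3\<close> into
        \<open>6\<close>.\<close>
      also have "\<dots> \<le> (q + 6 + 2 * (card T1 - 2)) * card A"
      proof -
        have "card {u, u'} \<le> card A" using good finA by (intro card_mono) auto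
        then have "4 \<le> 2 * card A" using good(4) by simp
        then show ?thesis by (simp add: add_mult_distrib)
      qed
      also have "\<dots> \<le> c * card A"
      proof (intro mult_le_mono1)
        have "card {t, t'} \<le> card T1" using tt fins by (intro card_mono) auto
        then have "2 \<le> card T1" using tt(3) by simp
        moreover have "q \<le> c + 1 - 2 * card T" by (simp add: q_def)
        ultimately show "q + 6 + 2 * (card T1 - 2) \<le> c" using s2 gap(1) by linarith
      qed
      finally show ?thesis .
    next
      case excl
      have "(\<Sum>v\<in>A. card (N v)) \<le> (\<Sum>v\<in>A. card T1 - 2 * (card A - 1))"
        using excl by (intro sum_mono) (meson Nat.le_diff_conv2 add_leD2)
      then have "(\<Sum>v\<in>A. card (N v)) \<le> card A * (card T1 - 2 * (card A - 1))" by simp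
      moreover have "card (arcs E A A) \<le> card A * (card A - 1)"
        by (rule card_arcs_self_le[OF finA loopless])
      \<comment> \<open>The edges to \<open>w\<close> add at most 2 per vertex of \<open>A\<close>,
        which \<open>s2\<close> covers.\<close>
      moreover have "card Q \<le> card A" using finA by (intro card_mono) (auto simp: Q_def)
      ultimately have "card (arcs E A A) + 2 * card Q + 2 * (\<Sum>v\<in>A. card (N v)) \<le>
        card A * (card A - 1) + card A * 2 + 2 * (card A * (card T1 - 2 * (card A - 1)))" by linarith
      also have "\<dots> = card A * (card A - 1 + 2 + 2 * (card T1 - 2 * (card A - 1)))"
        by (metis add_mult_distrib2 mult.left_commute)
      also have "\<dots> \<le> card A * c"
      proof (intro mult_le_mono2)
        have "2 * (card A - 1) \<le> card T1" using excl A(4) by force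
        then show "card A - 1 + 2 + 2 * (card T1 - 2 * (card A - 1)) \<le> c" using gap(1) s2 by linarith
      qed
      finally show ?thesis by (simp add: mult.commute)
    qed
  qed
qed

section \<open>The induction on the size of a piece\<close>

lemma gapped_nbrs_empty:
  assumes "gapped E k Y c H N" "D \<subseteq> H" "nbrs E H D = {}"
  shows "gapped E k Y c D N"
proof -
  have "nbrs E H W = nbrs E D W" if "W \<subseteq> D" for W
    using assms(2,3) that unfolding nbrs_def by blast
  then show ?thesis
    using assms(1,2) graph_path_mono[of D E _ H] finite_subset[of D H] unfolding gapped_def
    by (smt (verit, ccfv_threshold) UN_iff subset_iff)
qed

text \<open>Both sides of \<open>gap_bound\<close> are additive over a partition of
  \<open>H\<close>, except for the edges between the parts. There are none for a union of
  components; for an end part \<open>A\<close> they all go to \<open>w\<close> and are counted with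
  \<open>A\<close>.\<close>

lemma gapped_imp_gap_bound:
  fixes N :: "'a \<Rightarrow> nat set"
  assumes loopless: "\<And>v. {v} \<notin> E"
  shows "gapped E k Y c H N \<Longrightarrow> gap_bound E c H N"
proof (induction "card H" arbitrary: H k Y c N rule: less_induct)
  case less
  note g = less.prems
  have finH: "finite H" using g by (simp add: gapped_def)
  have IH: "\<And>H' k Y c (N :: 'a \<Rightarrow> nat set). H' \<subset> H \<Longrightarrow> gapped E k Y c H' N \<Longrightarrow> gap_bound E c H' N"
    using less.hyps psubset_card_mono[OF finH] by blast
  consider "H = {}" | (unlinked) "\<not> linked E H" | "H \<noteq> {}" "noncut E H" | (cut) "linked E H" "\<not> noncut E H"
    by blast
  then show ?case
  proof cases
    case 1
    then show ?thesis by (simp add: gap_bound_def arcs_def)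
  next
    case unlinked
    then obtain D where D: "D \<subseteq> H" "D \<noteq> {}" "nbrs E H D = {}" "D \<noteq> H" unfolding linked_def by blast
    have nonadj: "{u, v} \<notin> E" if "u \<in> D" "v \<in> H - D" for u v using D(3) that by (auto simp: nbrs_def)
    then have "nbrs E H (H - D) = {}" by (auto simp: nbrs_def insert_commute)
    then have "gap_bound E c D N" "gap_bound E c (H - D) N"
      using D by (auto intro!: IH gapped_nbrs_empty[OF g])
    moreover have fin: "finite D" "finite (H - D)" using finH D finite_subset by auto
    moreover have "H = D \<union> (H - D)" using D(1) by auto
    then have "card (arcs E H H) = card (arcs E D D) + 2 * card (arcs E D (H - D)) + card (arcs E (H - D) (H - D))"
      using card_arcs_Un[of D "H - D" E] fin by auto
    moreover have "arcs E D (H - D) = {}" using nonadj by (auto simp: arcs_def)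
    moreover have "(\<Sum>v\<in>H. card (N v)) = (\<Sum>v\<in>H - D. card (N v)) + (\<Sum>v\<in>D. card (N v))"
      by (rule sum.subset_diff[OF D(1) finH])
    moreover have "card H = card D + card (H - D)"
      using D(1) finH by (metis add.commute card_Diff_subset card_mono fin(1) le_add_diff_inverse2)
    ultimately show ?thesis by (simp add: gap_bound_def algebra_simps)
  next
    case 3
    then show ?thesis by (intro gap_bound_noncut[OF loopless IH g])
  next
    case cut
    define cutset where "cutset x W \<longleftrightarrow> W \<subseteq> H \<and> W \<noteq> {} \<and> nbrs E H W = {x} \<and> \<not> H - {x} \<subseteq> W" for x W
    have "\<exists>W. \<exists>x. cutset x W"
    proof -
      obtain W x where W: "W \<subseteq> H" "W \<noteq> {}" "nbrs E H W \<subseteq> {x}" "\<not> H - {x} \<subseteq> W"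
        using cut(2) unfolding noncut_def by blast
      then have "W \<noteq> H" by auto
      then have "nbrs E H W \<noteq> {}" using cut(1) W unfolding linked_def by blast
      then have "cutset x W" using W by (auto simp: cutset_def)
      then show ?thesis by blast
    qed
    then obtain A where "\<exists>x. cutset x A" and minimal: "\<And>W. \<exists>x. cutset x W \<Longrightarrow> card A \<le> card W"
      using ex_has_least_nat[of "\<lambda>W. \<exists>x. cutset x W" _ card] by metis
    then obtain w where A: "A \<subseteq> H" "nbrs E H A = {w}" "\<not> H - {w} \<subseteq> A" "A \<noteq> {}" by (auto simp: cutset_def)
    have noncut: "noncut E (insert w A)"
      using minimal by (intro noncut_min_cut[OF cut(1) A(1-3) finH]) (auto simp: cutset_def)
    define Q where "Q = {v \<in> A. {v, w} \<in> E}"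
    define H' where "H' = H - A"
    have w: "w \<in> H" "w \<notin> A" using A(2) by (auto simp: nbrs_def)
    have fin: "finite A" "finite H'" using finH A(1) finite_subset by (auto simp: H'_def)
    have 1: "card (arcs E A A) + 2 * card Q + 2 * (\<Sum>v\<in>A. card (N v)) \<le> c * card A"
      unfolding Q_def by (rule end_part_bound[OF loopless IH g cut(1) A noncut])
    have "gap_bound E c H' (N(w := N w \<union> \<Union>(N ` A)))"
      unfolding H'_def using gapped_contract[OF g cut(1) A(1,2) noncut] A by (intro IH) auto
    then have "card (arcs E H' H') + 2 * (\<Sum>v\<in>H'. card ((N(w := N w \<union> \<Union>(N ` A))) v)) \<le> c * card H'"
      by (simp add: gap_bound_def)
    \<comment> \<open>Contraction only enlarges \<open>N w\<close>, so the bound for the contracted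
      piece implies the one with the original attachments.\<close>
    moreover have "(\<Sum>v\<in>H'. card (N v)) \<le> (\<Sum>v\<in>H'. card ((N(w := N w \<union> \<Union>(N ` A))) v))"
    proof (intro sum_mono card_mono)
      fix v assume "v \<in> H'"
      then show "finite ((N(w := N w \<union> \<Union>(N ` A))) v)"
        using g w fin(1) A(1) by (auto simp: gapped_def H'_def)
    qed auto
    ultimately have 2: "card (arcs E H' H') + 2 * (\<Sum>v\<in>H'. card (N v)) \<le> c * card H'" by linarith
    have "arcs E A H' = (\<lambda>v. (v, w)) ` Q"
    proof -
      have "v = w" if "a \<in> A" "v \<in> H'" "{a, v} \<in> E" for a v
      proof -
        have "v \<in> nbrs E H A" using that by (auto simp: nbrs_def H'_def)
        then show ?thesis using A(2) by simp
      qed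
      then show ?thesis using w by (auto simp: arcs_def Q_def H'_def)
    qed
    then have 3: "card (arcs E A H') = card Q" by (simp add: card_image inj_on_def)
    have "H = A \<union> H'" "A \<inter> H' = {}" using A(1) by (auto simp: H'_def)
    then have 4: "card (arcs E H H) = card (arcs E A A) + 2 * card Q + card (arcs E H' H')"
      and 5: "card H = card A + card H'"
      and 6: "(\<Sum>v\<in>H. card (N v)) = (\<Sum>v\<in>A. card (N v)) + (\<Sum>v\<in>H'. card (N v))"
      using fin card_arcs_Un[of A H' E] 3 by (simp_all add: card_Un_disjoint sum.union_disjoint)
    show ?thesis
      using 1 2 unfolding gap_bound_def 4 5 6 by (simp add: add_mult_distrib2)
  qed
qed

subsection \<open>Cycles through prescribed vertices\<close>

lemma graph_path_take_drop:
  assumes "graph_path V E c" "n \<le> m" "m < length c"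
  shows "graph_path V E (take (Suc n) c)" "graph_path V E (drop m c)"
    "last (take (Suc n) c) = c ! n" "hd (drop m c) = c ! m"
proof -
  have s: "successively (\<lambda>u v. {u, v} \<in> E) c" "distinct c" "set c \<subseteq> V" using assms(1) by (auto simp: graph_path_def)
  have "successively (\<lambda>u v. {u, v} \<in> E) (take i c)" "successively (\<lambda>u v. {u, v} \<in> E) (drop i c)" for i
    using s(1) by (metis append_take_drop_id successively_append_iff)+
  then show "graph_path V E (take (Suc n) c)" "graph_path V E (drop m c)"
    using s assms(2,3) by (auto simp: graph_path_def dest: in_set_takeD in_set_dropD)
  show "last (take (Suc n) c) = c ! n" "hd (drop m c) = c ! m"
    using assms(2,3) by (simp_all add: take_Suc_conv_app_nth hd_drop_conv_nth)
qed

lemma graph_cycle_detour: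
  assumes c: "graph_cycle V E c" and t: "t < t'" "t' < length c"
    and r: "graph_path V E r" "set r \<inter> set c = {}" "{c ! t, hd r} \<in> E" "{last r, c ! t'} \<in> E"
  shows "graph_cycle V E (take (Suc t) c @ r @ drop t' c)"
proof -
  have p: "graph_path V E c" and e: "{last c, hd c} \<in> E" using c by (auto simp: graph_cycle_def)
  note td = graph_path_take_drop[OF p less_imp_le[OF t(1)] t(2)]
  have ne: "take (Suc t) c \<noteq> []" "drop t' c \<noteq> []" "r \<noteq> []" "r @ drop t' c \<noteq> []"
    using t r(1) by (auto simp: graph_path_def)
  have "set (take (Suc t) c) \<inter> set (drop t' c) = {}"
    using p t by (intro set_take_disj_set_drop_if_distinct) (auto simp: graph_path_def)
  moreover have "set r \<inter> set (take (Suc t) c) = {}" "set r \<inter> set (drop t' c) = {}"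
    using r(2) by (auto dest: in_set_takeD in_set_dropD)
  ultimately have "graph_path V E (take (Suc t) c @ r @ drop t' c)"
    using r td ne by (auto simp: graph_path_append)
  moreover have "last (take (Suc t) c @ r @ drop t' c) = last c" "hd (take (Suc t) c @ r @ drop t' c) = hd c"
    using t ne by (auto simp: hd_append)
  moreover have "length (take (Suc t) c @ r @ drop t' c) \<ge> 3"
  proof -
    have "length r \<ge> 1" using ne(3) by (cases r) auto
    then show ?thesis using t by auto
  qed
  ultimately show ?thesis using e unfolding graph_cycle_def by simp
qed

lemma graph_cycle_extend:
  assumes c: "graph_cycle V E c"
    and r: "graph_path V E r" "set r \<inter> set c = {}" "{last c, hd r} \<in> E" "{last r, hd c} \<in> E"
  shows "graph_cycle V E (c @ r)"
proof -
  have "c \<noteq> []" "r \<noteq> []" using c r(1) by (auto simp: graph_cycle_def graph_path_def)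
  then show ?thesis using c r by (auto simp: graph_cycle_def graph_path_append)
qed

lemma graph_cycle_rotate:
  assumes "graph_cycle V E c" "y \<in> set c"
  obtains c' where "graph_cycle V E c'" "set c' = set c" "length c' = length c" "c' ! 0 = y"
proof -
  obtain a b where c: "c = a @ y # b" using assms(2) by (meson split_list)
  have "graph_cycle V E (y # b @ a)"
  proof (cases "a = []")
    case False
    have "graph_path V E a" "graph_path V E (y # b)" "set a \<inter> set (y # b) = {}"
      "{last a, y} \<in> E" "{last (y # b), hd a} \<in> E" "length c \<ge> 3"
      using assms(1) False unfolding c graph_cycle_def
      by (auto simp: graph_path_append split: if_splits)
    then have "graph_path V E ((y # b) @ a)"
      using False by (subst graph_path_append) auto
    then show ?thesis
      using \<open>{last a, y} \<in> E\<close> \<open>length c \<ge> 3\<close> False by (simp add: graph_cycle_def c)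
  qed (use assms(1) c in simp)
  then show thesis by (rule that) (auto simp: c)
qed

text \<open>Menger's theorem for two paths: if no single vertex other than \<open>y\<close> separates \<open>y\<close> from \<open>S\<close>, some path
  with both ends in \<open>S\<close> runs through \<open>y\<close>. Induction along a path from \<open>y\<close> to \<open>S\<close>: a path through the next
  vertex is rerouted through \<open>y\<close>.\<close>

lemma two_fan:
  assumes "graph_path U E p" "hd p \<notin> S" "last p \<in> S"
    and "\<And>x. x \<noteq> hd p \<Longrightarrow> \<exists>q. graph_path (U - {x}) E q \<and> hd q = hd p \<and> last q \<in> S"
  shows "\<exists>r. graph_path U E r \<and> hd p \<in> set r \<and> hd r \<noteq> last r \<and> set r \<inter> S = {hd r, last r}"
  using assms
proof (induction p)
  case Nil
  then show ?case by (simp add: graph_path_def)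
next
  case (Cons y p)
  have yS: "y \<notin> S" using Cons.prems(2) by simp
  have "p \<noteq> []" using Cons.prems(2,3) by auto
  then obtain z p' where p: "p = z # p'" by (cases p) auto
  have pp: "graph_path U E p" "y \<notin> set p" "y \<in> U" "{y, z} \<in> E" and lp: "last p \<in> S"
    using Cons.prems p by (auto simp: graph_path_def)
  have zU: "z \<in> U" "z \<noteq> y" using pp p by (auto simp: graph_path_def)
  have first: "\<exists>s. graph_path (U - {x}) E s \<and> hd s = y \<and> last s \<in> X \<and> set s \<inter> X = {last s}"
    if x: "x \<noteq> y" and X: "S \<subseteq> X" "y \<notin> X" for x X
  proof -
    obtain q where q: "graph_path (U - {x}) E q" "hd q = y" "last q \<in> S"
      using Cons.prems(4)[of x] x by auto
    then have "\<exists>v\<in>set q. v \<in> X" using X(1) last_in_set[of q] by (auto simp: graph_path_def)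
    then obtain a v b where a: "q = a @ v # b" "v \<in> X" "\<forall>u\<in>set a. u \<notin> X"
      using split_list_first_prop[of q "\<lambda>v. v \<in> X"] by blast
    have "a \<noteq> []" using a(1,2) q(2) X(2) by (cases a) auto
    have "graph_path (U - {x}) E ((a @ [v]) @ b)" using q(1) a(1) by simp
    then have "graph_path (U - {x}) E (a @ [v])"
      by (cases "b = []") (simp_all add: graph_path_append del: append_assoc)
    moreover have "hd (a @ [v]) = y" using q(2) a(1) \<open>a \<noteq> []\<close> by simp
    ultimately show ?thesis using a(2,3) by (intro exI[of _ "a @ [v]"]) auto
  qed
  show ?case
  proof (cases "z \<in> S")
    case True
    obtain s where s: "graph_path (U - {z}) E s" "hd s = y" "last s \<in> S" "set s \<inter> S = {last s}"
      using first[of z S] zU(2) yS by blast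
    have sne: "s \<noteq> []" "z \<notin> set s" using s(1) by (auto simp: graph_path_def)
    have "graph_path U E ([z] @ s)"
      using sne zU s(2) pp(4) graph_path_mono[OF s(1), of U]
      by (subst graph_path_append) (auto simp: graph_path_single insert_commute)
    moreover have "last s \<in> set s" "hd s \<in> set s" using sne by auto
    ultimately show ?thesis
      using True s sne by (intro exI[of _ "z # s"]) auto
  next
    case False
    \<comment> \<open>The hypothesis passes from \<open>y\<close> to \<open>z\<close>. The rest of
      the given path avoids \<open>y\<close>; for other \<open>x\<close>, a path from
      \<open>y\<close> avoiding \<open>x\<close> is either entered at \<open>z\<close> or preceded
      by \<open>z\<close>.\<close>
    have "\<exists>q. graph_path (U - {x}) E q \<and> hd q = z \<and> last q \<in> S" if "x \<noteq> z" for x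
    proof (cases "x = y")
      case True
      then have "graph_path (U - {x}) E p" using pp(1,2) by (auto simp: graph_path_def)
      then show ?thesis using lp p by auto
    next
      case x: False
      obtain q where q: "graph_path (U - {x}) E q" "hd q = y" "last q \<in> S"
        using Cons.prems(4)[of x] x by auto
      have qne: "q \<noteq> []" using q(1) by (auto simp: graph_path_def)
      show ?thesis
      proof (cases "z \<in> set q")
        case True
        then obtain a b where ab: "q = a @ z # b" by (meson split_list)
        then have "graph_path (U - {x}) E (z # b)"
          using q(1) by (cases "a = []") (auto simp: graph_path_append)
        then show ?thesis using q(3) ab by (intro exI[of _ "z # b"]) simp
      next
        case False
        then have "graph_path (U - {x}) E ([z] @ q)"
          using q qne zU(1) that pp(4) by (subst graph_path_append) (auto simp: graph_path_single insert_commute)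
        then show ?thesis using q(3) qne by (intro exI[of _ "z # q"]) simp
      qed
    qed
    then obtain r where r: "graph_path U E r" "z \<in> set r" "hd r \<noteq> last r" "set r \<inter> S = {hd r, last r}"
      using Cons.IH[OF pp(1)] False lp p by auto
    show ?thesis
    proof (cases "y \<in> set r")
      case True
      then show ?thesis using r by auto
    next
      case y: False
      obtain s where s: "graph_path (U - {z}) E s" "hd s = y" "last s \<in> S \<union> set r"
          "set s \<inter> (S \<union> set r) = {last s}"
        using first[of z "S \<union> set r"] zU(2) yS y by blast
      have sne: "s \<noteq> []" and sz: "z \<notin> set s" using s(1) by (auto simp: graph_path_def)
      have only: "v = last s" if "v \<in> set s" "v \<in> S \<or> v \<in> set r" for v using that s(4) by blast
      have zl: "last s \<noteq> z" using sne sz by auto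
      \<comment> \<open>\<open>r'\<close> is \<open>r\<close> or its reverse, oriented so that
        \<open>s\<close> does not end on the part \<open>b\<close> before \<open>z\<close>. The new
        path follows \<open>b\<close>, \<open>z\<close> and \<open>s\<close>; it stops there if
        \<open>s\<close> ends off \<open>r\<close>, hence in \<open>S\<close>, and otherwise
        continues along the rest of \<open>d\<close>.\<close>
      have build: ?thesis
        if r': "graph_path U E r'" "set r' = set r" "hd r' \<noteq> last r'" "{hd r', last r'} = {hd r, last r}"
          and bd: "r' = b @ z # d" and l: "last s \<notin> set b" for r' b d
      proof -
        have zS: "z \<noteq> hd r" "z \<noteq> last r" using False r(4) by auto
        have "b \<noteq> []" using bd r'(4) zS by (cases b) auto
        have b1: "graph_path U E (b @ [z])" "set d \<inter> set (b @ [z]) = {}"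
          using r'(1) \<open>b \<noteq> []\<close> unfolding bd by (auto simp: graph_path_def successively_append_iff)
        have disj: "set (b @ [z]) \<inter> set s = {}"
        proof -
          have "set b \<subseteq> set r" using bd r'(2) by auto
          then show ?thesis using only l sz by auto
        qed
        have bs: "graph_path U E ((b @ [z]) @ s)"
          using b1(1) graph_path_mono[OF s(1), of U] disj sne s(2) pp(4)
          by (subst graph_path_append) (auto simp: insert_commute)
        have hdr': "hd r' = hd b" using bd \<open>b \<noteq> []\<close> by simp
        have rS: "set r' \<inter> S = {hd r', last r'}" using r(4) r'(2,4) by simp
        show ?thesis
        proof (cases "last s \<in> set r")
          case False
          have lS: "last s \<in> S" using s(3) False by simp
          have "d \<noteq> []" using bd r'(4) zS by (cases d) auto
          then have "last r' \<in> set d" using bd by simp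
          then have "last r' \<notin> set (b @ [z])" using b1(2) by auto
          moreover have bset: "set (b @ [z]) \<subseteq> set r'" "hd r' \<in> set b" using bd hdr' \<open>b \<noteq> []\<close> by auto
          ultimately have "set (b @ [z]) \<inter> S = {hd r'}" using rS by auto
          moreover have "set s \<inter> S = {last s}" using only lS sne last_in_set by blast
          moreover have "hd r' \<in> set r" using bset \<open>hd r' \<in> set b\<close> r'(2) by auto
          then have "hd r' \<noteq> last s" using False by metis
          moreover have "hd ((b @ [z]) @ s) = hd r'" "last ((b @ [z]) @ s) = last s"
            using hdr' sne \<open>b \<noteq> []\<close> by auto
          moreover have "y \<in> set ((b @ [z]) @ s)" using s(2) hd_in_set[OF sne] by simp
          moreover have "set ((b @ [z]) @ s) = set (b @ [z]) \<union> set s" by simp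
          ultimately show ?thesis
            using bs by (intro exI[of _ "(b @ [z]) @ s"]) (simp only: list.sel Int_Un_distrib2, auto)
        next
          case True
          then have "last s \<in> set r'" using r'(2) by simp
          then have "last s \<in> set d" using l zl unfolding bd by simp
          then obtain d1 d2 where d: "d = d1 @ last s # d2" by (meson split_list)
          have p2: "graph_path U E (last s # d2)"
            using r'(1) unfolding bd d by (auto simp: graph_path_def successively_append_iff successively_Cons)
          have d2: "set d2 \<inter> set s = {}"
          proof -
            have "set d2 \<subseteq> set r'" "last s \<notin> set d2" using bd d p2 by (auto simp: graph_path_def)
            then have "set d2 \<subseteq> set r" "last s \<notin> set d2" using r'(2) by simp_all
            then show ?thesis using only by auto
          qed
          have d2b: "set d2 \<inter> set (b @ [z]) = {}" using b1(2) d by auto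
          let ?q = "((b @ [z]) @ s) @ d2"
          have q: "graph_path U E ?q"
          proof (cases "d2 = []")
            case d2ne: False
            have "graph_path U E d2 \<and> {last s, hd d2} \<in> E"
              using p2 d2ne by (auto simp: graph_path_def successively_Cons)
            then show ?thesis using bs d2 d2b d2ne sne by (subst graph_path_append) auto
          qed (use bs in simp)
          have lq: "last ?q = last r'" using sne unfolding bd d by (cases "d2 = []") auto
          have hq: "hd ?q = hd r'" using hdr' \<open>b \<noteq> []\<close> by simp
          have "set ?q \<inter> S = {hd r', last r'}"
          proof
            have "x \<in> set r'" if x: "x \<in> set ?q" "x \<in> S" for x
            proof (cases "x \<in> set s")
              case s: True
              then have "x = last s" using only x(2) by simp
              then show ?thesis using True r'(2) by simp
            qed (use x(1) in \<open>auto simp: bd d\<close>)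
            then show "set ?q \<inter> S \<subseteq> {hd r', last r'}" using rS by auto
            have "hd ?q \<in> set ?q" "last ?q \<in> set ?q" using sne by (intro hd_in_set last_in_set; simp)+
            then show "{hd r', last r'} \<subseteq> set ?q \<inter> S" using rS unfolding lq hq by auto
          qed
          moreover have "y \<in> set ?q" using s(2) sne hd_in_set[OF sne] by simp
          ultimately show ?thesis using q r'(3) lq hq by (intro exI[of _ ?q]) simp
        qed
      qed
      obtain b d where bd: "r = b @ z # d" using r(2) by (meson split_list)
      have rne: "r \<noteq> []" using r(2) by auto
      show ?thesis
      proof (cases "last s \<in> set b")
        case False
        then show ?thesis using build[of r b d] r bd by simp
      next
        case True
        have "last s \<notin> set d" using r(1) True unfolding bd by (auto simp: graph_path_def)
        then have "last s \<notin> set (rev d)" by simp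
        moreover have "graph_path U E (rev r)" "set (rev r) = set r" using r(1) by (simp_all add: graph_path_rev)
        moreover have "{hd (rev r), last (rev r)} = {hd r, last r}" "hd (rev r) \<noteq> last (rev r)"
          using r(3) rne by (auto simp: hd_rev last_rev)
        moreover have "rev r = rev d @ z # rev b" using bd by simp
        ultimately show ?thesis by (intro build[of "rev r" "rev d" "rev b"])
      qed
    qed
  qed
qed

section \<open>Consequences of k-connectedness\<close>

lemma k_connected_path:
  assumes "k_connected k V E" "S \<subseteq> V" "card S < k" "u \<in> V - S" "v \<in> V - S"
  obtains p where "graph_path (V - S) E p" "hd p = u" "last p = v"
proof -
  obtain p where p: "graph_path (V - S) (del_edges E S) p" "hd p = u" "last p = v"
    using assms unfolding k_connected_def graph_connected_def by meson
  have "graph_path (V - S) E p"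
    using p(1) unfolding graph_path_def
    by (auto intro: successively_mono simp: del_edges_def)
  then show thesis using that p by blast
qed

lemma k_connected_nbr:
  assumes "k_connected k V E" "S \<subseteq> V" "card S < k" "u \<in> V - S" "v \<in> V - S" "u \<noteq> v"
  obtains x where "x \<in> V - S" "x \<noteq> u" "{u, x} \<in> E"
proof -
  obtain p where p: "graph_path (V - S) E p" "hd p = u" "last p = v"
    using k_connected_path[OF assms(1-5)] .
  then obtain p' where p': "p = u # p'" by (cases p) (auto simp: graph_path_def)
  then have "p' \<noteq> []" using p(3) assms(6) by auto
  then obtain x p'' where "p' = x # p''" by (cases p') auto
  then show thesis using p(1) p' by (intro that[of x]) (auto simp: graph_path_def)
qed

text \<open>A path from \<open>W\<close> to \<open>z\<close> that avoids the boundary of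
  \<open>W\<close> could never leave \<open>W\<close>.\<close>

lemma k_connected_nbrs:
  assumes conn: "k_connected k V E" and fin: "finite V" and W: "W \<subseteq> V" "W \<noteq> {}"
    and z: "z \<in> V" "z \<notin> W" "z \<notin> nbrs E V W"
  shows "k \<le> card (nbrs E V W)"
proof (rule ccontr)
  assume "\<not> k \<le> card (nbrs E V W)"
  moreover obtain w where w: "w \<in> W" using W(2) by blast
  moreover have "nbrs E V W \<subseteq> V" "w \<in> V - nbrs E V W" using w W(1) by (auto simp: nbrs_def)
  ultimately obtain p where p: "graph_path (V - nbrs E V W) E p" "hd p = w" "last p = z"
    using k_connected_path[OF conn, of "nbrs E V W" w z] z by auto
  have "set p \<subseteq> W"
    using p(1,2) w
  proof (induction p arbitrary: w)
    case (Cons x p)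
    have x: "x \<in> W" using Cons.prems by simp
    show ?case
    proof (cases p)
      case (Cons y p')
      have y: "y \<in> V - nbrs E V W" "{x, y} \<in> E" "graph_path (V - nbrs E V W) E p"
        using Cons.prems(1) Cons by (auto simp: graph_path_def)
      then have "y \<in> W" using x by (auto simp: nbrs_def)
      then show ?thesis using Cons.IH[OF y(3) _ \<open>y \<in> W\<close>] x Cons by simp
    qed (use x in simp)
  qed simp
  moreover have "p \<noteq> []" using p(1) by (auto simp: graph_path_def)
  ultimately show False using p(3) z(2) last_in_set by blast
qed

text \<open>Two neighbours of \<open>y\<close> are joined by a path avoiding \<open>y\<close>; the
  second neighbour is found after deleting the first.\<close>

lemma cycle_through_vertex:
  assumes conn: "k_connected k V E" and fin: "finite V" and k: "2 \<le> k" and y: "y \<in> V"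
  obtains c where "graph_cycle V E c" "y \<in> set c"
proof -
  have cV: "3 \<le> card V" using conn k unfolding k_connected_def by linarith
  have other: "\<exists>v\<in>V. v \<noteq> a \<and> v \<noteq> b" for a b
  proof (rule ccontr)
    assume "\<not> ?thesis"
    then have "card V \<le> card {a, b}" by (intro card_mono) auto
    also have "\<dots> \<le> 2" by (simp add: card_insert_if)
    finally show False using cV by simp
  qed
  obtain v where v: "v \<in> V" "v \<noteq> y" using other by blast
  obtain z1 where z1: "z1 \<in> V" "z1 \<noteq> y" "{y, z1} \<in> E"
    using k_connected_nbr[OF conn, of "{}" y v] v y k by auto
  obtain v' where v': "v' \<in> V" "v' \<noteq> y" "v' \<noteq> z1" using other by blast
  obtain z2 where z2: "z2 \<in> V" "z2 \<noteq> y" "z2 \<noteq> z1" "{y, z2} \<in> E"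
    using k_connected_nbr[OF conn, of "{z1}" y v'] v' y k z1 by auto
  obtain p where p: "graph_path (V - {y}) E p" "hd p = z1" "last p = z2"
    using k_connected_path[OF conn, of "{y}" z1 z2] y k z1 z2 by auto
  have pne: "p \<noteq> []" using p(1) by (auto simp: graph_path_def)
  have "graph_path V E ([y] @ p)"
    using p z1 y pne by (subst graph_path_append) (auto simp: graph_path_def)
  moreover have "length p \<ge> 2"
    using pne p(2,3) z2(3) by (cases p; cases "tl p") auto
  ultimately have "graph_cycle V E (y # p)"
    using p(3) z2(4) pne by (simp add: graph_cycle_def insert_commute)
  then show thesis using that by simp
qed

text \<open>The inner part of \<open>r\<close> avoids the cycle altogether, so it can replace the
  vertices strictly between the positions of its two ends. The last conclusion records that nothing
  else is lost.\<close>

lemma graph_cycle_reroute: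
  assumes c: "graph_cycle V E c" and S: "S \<subseteq> set c" and y: "y \<notin> set c"
    and r: "graph_path (V - (set c - S)) E r" "y \<in> set r" "hd r \<noteq> last r" "set r \<inter> S = {hd r, last r}"
  obtains t t' c' where "t < t'" "t' < length c" "c ! t \<in> S" "c ! t' \<in> S" "graph_cycle V E c'" "y \<in> set c'"
    "\<And>i. i < length c \<Longrightarrow> i \<le> t \<or> t' \<le> i \<Longrightarrow> c ! i \<in> set c'"
proof -
  note result = that
  have main: thesis
    if r: "graph_path (V - (set c - S)) E r" "y \<in> set r" "set r \<inter> S = {hd r, last r}"
      and t: "hd r = c ! t" "last r = c ! t'" "t < t'" "t' < length c" for r t t'
  proof -
    have dc: "distinct c" using c by (auto simp: graph_cycle_def graph_path_def)
    have ends: "c ! t \<in> S" "c ! t' \<in> S" using r(3) t by auto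
    have ne: "hd r \<noteq> last r" using t dc by (simp add: nth_eq_iff_index_eq)
    have "r \<noteq> []" using r(2) by auto
    then obtain r1 where r1: "r = hd r # r1" by (cases r) auto
    have "r1 \<noteq> []" using r1 ne by (metis last_ConsL)
    then obtain s where s: "r1 = s @ [last r]" using r1 by (metis append_butlast_last_id last_ConsR)
    have rs: "r = hd r # s @ [last r]" using r1 s by simp
    have "hd r \<in> set c" "last r \<in> set c" using ends S t by auto
    then have "s \<noteq> []" using r(2) rs y by (metis append_Nil empty_iff empty_set set_ConsD)
    have gs: "graph_path (V - (set c - S)) E ((hd r # s) @ [last r])" using r(1) rs by simp
    then have "graph_path (V - (set c - S)) E (hd r # s)" "{last s, last r} \<in> E" "last r \<notin> set s"
      using \<open>s \<noteq> []\<close> by (auto simp: graph_path_append simp del: append_Cons)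
    then have sp: "graph_path (V - (set c - S)) E s" "{hd r, hd s} \<in> E" "{last s, last r} \<in> E"
        "hd r \<notin> set s" "last r \<notin> set s"
      using \<open>s \<noteq> []\<close> by (auto simp: graph_path_Cons)
    have rset: "set r = insert (hd r) (insert (last r) (set s))"
      by (subst rs) auto
    have "set s \<inter> S \<subseteq> {hd r, last r}" using rset r(3) by blast
    then have "set s \<inter> S = {}" using sp(4,5) by blast
    then have "set s \<inter> set c = {}" using sp(1) by (auto simp: graph_path_def)
    moreover have "graph_path V E s" using graph_path_mono[OF sp(1)] by auto
    ultimately have cyc: "graph_cycle V E (take (Suc t) c @ s @ drop t' c)"
      using sp(2,3) t by (intro graph_cycle_detour[OF c]) auto
    have "y \<in> set s"
      using r(2) y \<open>hd r \<in> set c\<close> \<open>last r \<in> set c\<close> unfolding rset by auto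
    then have ys: "y \<in> set (take (Suc t) c @ s @ drop t' c)" by simp
    have ins: "c ! i \<in> set (take (Suc t) c @ s @ drop t' c)" if "i < length c" "i \<le> t \<or> t' \<le> i" for i
    proof -
      have "c ! i \<in> set (take (Suc t) c)" if "i \<le> t"
        using that t \<open>i < length c\<close> by (auto simp: in_set_conv_nth intro!: exI[of _ i])
      moreover have "c ! i \<in> set (drop t' c)" if "t' \<le> i"
        using that \<open>i < length c\<close> by (auto simp: in_set_conv_nth intro!: exI[of _ "i - t'"])
      ultimately show ?thesis using that(2) by auto
    qed
    show thesis by (rule result[OF t(3,4) ends cyc ys ins])
  qed
  have "hd r \<in> set c" "last r \<in> set c" using r(4) S by auto
  then obtain t t' where t: "t < length c" "hd r = c ! t" "t' < length c" "last r = c ! t'"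
    by (auto simp: in_set_conv_nth)
  have rne: "r \<noteq> []" using r(2) by auto
  show thesis
  proof (cases "t < t'")
    case True
    then show thesis using main[of r t t'] r t by simp
  next
    case False
    then have "t' < t" using r(3) t by (cases "t = t'") auto
    moreover have "set (rev r) \<inter> S = {hd (rev r), last (rev r)}" using r(4) rne by (auto simp: hd_rev last_rev)
    ultimately show thesis
      using main[of "rev r" t' t] r(1,2) t rne by (simp add: graph_path_rev hd_rev last_rev)
  qed
qed

lemma cycle_through_set:
  assumes conn: "k_connected k V E" and fin: "finite V" and k: "2 \<le> k"
    and Y: "Y \<subseteq> V" "card Y = k - 1"
  obtains c where "graph_cycle V E c" "Y \<subseteq> set c"
proof -
  have finY: "finite Y" using Y(1) fin finite_subset by blast
  obtain y0 where y0: "y0 \<in> Y" using Y(2) k by fastforce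
  define good where "good c \<longleftrightarrow> graph_cycle V E c \<and> Y \<inter> set c \<noteq> {}" for c
  obtain c0 where "graph_cycle V E c0" "y0 \<in> set c0"
    using cycle_through_vertex[OF conn fin k, of y0] y0 Y(1) by blast
  then have "good c0" using y0 by (auto simp: good_def)
  moreover have "\<forall>c. good c \<longrightarrow> card (Y \<inter> set c) < card Y + 1"
    using card_mono[OF finY Int_lower1] by (simp add: less_Suc_eq_le)
  ultimately obtain c1 where c1: "good c1"
    and max1: "\<And>c. good c \<Longrightarrow> card (Y \<inter> set c) \<le> card (Y \<inter> set c1)"
    using ex_has_greatest_nat[of good c0 "\<lambda>c. card (Y \<inter> set c)" "card Y + 1"] by blast
  obtain z where z: "z \<in> Y" "z \<in> set c1" using c1 by (auto simp: good_def)
  \<comment> \<open>Starting at a vertex of \<open>Y\<close> ensures that every position has a last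
    \<open>Y\<close>-position at or before it.\<close>
  obtain c where c: "graph_cycle V E c" "set c = set c1" "c ! 0 = z"
    using graph_cycle_rotate[of V E c1 z] c1 z(2) by (auto simp: good_def)
  have max: "card (Y \<inter> set c') \<le> card (Y \<inter> set c)"
    if "graph_cycle V E c'" "Y \<inter> set c \<subseteq> set c'" for c'
    using that z c(2) by (intro max1[of c', folded c(2)]) (auto simp: good_def)
  have "Y \<subseteq> set c"
  proof (rule ccontr)
    assume "\<not> Y \<subseteq> set c"
    then obtain y where y: "y \<in> Y" "y \<notin> set c" by blast
    have yV: "y \<in> V" using y Y by blast
    have dc: "distinct c" and cV: "set c \<subseteq> V" and len: "length c \<ge> 3"
      using c(1) by (auto simp: graph_cycle_def graph_path_def)
    have cc: "card (set c) = length c" using dc by (rule distinct_card)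
    have contra: False if "graph_cycle V E c'" "y \<in> set c'" "Y \<inter> set c \<subseteq> set c'" for c'
    proof -
      have "card (insert y (Y \<inter> set c)) \<le> card (Y \<inter> set c')"
        using that y finY by (intro card_mono) auto
      then show False using max[OF that(1,3)] y(2) finY by simp
    qed
    \<comment> \<open>Otherwise \<open>two_fan\<close> and \<open>graph_cycle_reroute\<close> would
      give a cycle through \<open>y\<close> that loses only vertices between two positions of
      \<open>S\<close>, none of them in \<open>Y\<close>, against maximality.\<close>
    have fan: "\<exists>x. x \<noteq> y \<and> x \<in> U \<and> (\<forall>q. graph_path (U - {x}) E q \<and> hd q = y \<longrightarrow> last q \<notin> S)"
      if S: "S \<subseteq> set c" "S \<noteq> {}" and U: "U = V - (set c - S)"
        and seg: "\<And>t t' i. c ! t \<in> S \<Longrightarrow> c ! t' \<in> S \<Longrightarrow> t < i \<Longrightarrow> i < t' \<Longrightarrow> t' < length c \<Longrightarrow> c ! i \<notin> Y"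
      for S U
    proof (rule ccontr)
      assume "\<not> ?thesis"
      then have avoid: "\<exists>q. graph_path (U - {x}) E q \<and> hd q = y \<and> last q \<in> S" if "x \<noteq> y" "x \<in> U" for x
        using that by metis
      \<comment> \<open>Avoiding \<open>s\<close> is only a means of obtaining one path from
        \<open>y\<close> to \<open>S\<close>, along which \<open>two_fan\<close> can
        proceed.\<close>
      obtain s where s: "s \<in> S" using S(2) by blast
      then have "s \<noteq> y" "s \<in> U" using y S(1) cV U by auto
      then obtain p where p0: "graph_path (U - {s}) E p" "hd p = y" "last p \<in> S" using avoid by blast
      have p: "graph_path U E p" using graph_path_mono[OF p0(1)] by auto
      have "\<exists>q. graph_path (U - {x}) E q \<and> hd q = hd p \<and> last q \<in> S" if "x \<noteq> hd p" for x
      proof (cases "x \<in> U")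
        case True
        then show ?thesis using avoid[of x] that p0(2) by simp
      next
        case False
        then have "U - {x} = U" by simp
        then show ?thesis using p p0(3) by auto
      qed
      moreover have "hd p \<notin> S" using y(2) S(1) p0(2) by auto
      ultimately obtain r where r: "graph_path U E r" "y \<in> set r" "hd r \<noteq> last r" "set r \<inter> S = {hd r, last r}"
        using two_fan[OF p _ p0(3)] p0(2) by blast
      obtain t t' c' where t: "t < t'" "t' < length c" "c ! t \<in> S" "c ! t' \<in> S" "graph_cycle V E c'" "y \<in> set c'"
        and c': "\<And>i. i < length c \<Longrightarrow> i \<le> t \<or> t' \<le> i \<Longrightarrow> c ! i \<in> set c'"
        using graph_cycle_reroute[OF c(1) S(1) y(2) r(1)[unfolded U] r(2-4)] by metis
      have "Y \<inter> set c \<subseteq> set c'"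
      proof
        fix v assume v: "v \<in> Y \<inter> set c"
        then obtain i where i: "i < length c" "v = c ! i" by (auto simp: in_set_conv_nth)
        then have "i \<le> t \<or> t' \<le> i" using seg[OF t(3,4) _ _ t(2), of i] v by force
        then show "v \<in> set c'" using c'[OF i(1)] i(2) by simp
      qed
      then show False using contra t(5,6) by blast
    qed
    show False
    proof (cases "length c < k")
      case True
      \<comment> \<open>One separator per segment might cover a cycle with fewer than
        \<open>k\<close> vertices. Instead two consecutive vertices serve as the segment, and their
        separator is deleted together with the other \<open>length c - 2\<close> vertices of the
        cycle, fewer than \<open>k\<close> in all.\<close>
      define S where "S = {c ! 0, c ! 1}"
      define U where "U = V - (set c - S)"
      have c01: "c ! 0 \<noteq> c ! 1" using nth_eq_iff_index_eq[OF dc, of 0 1] len by linarith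
      have "c ! 0 \<in> set c" "c ! 1 \<in> set c" using len by (intro nth_mem; linarith)+
      then have S: "S \<subseteq> set c" "S \<noteq> {}" "card S = 2"
        using c01 by (auto simp: S_def)
      have S01: "i \<le> 1" if "c ! i \<in> S" "i < length c" for i
      proof -
        have "c ! i = c ! 0 \<or> c ! i = c ! 1" using that(1) by (auto simp: S_def)
        moreover have "0 < length c" "1 < length c" using len by auto
        ultimately show ?thesis using that(2) nth_eq_iff_index_eq[OF dc that(2)] by auto
      qed
      have "\<exists>x. x \<noteq> y \<and> x \<in> U \<and> (\<forall>q. graph_path (U - {x}) E q \<and> hd q = y \<longrightarrow> last q \<notin> S)"
      proof (rule fan[OF S(1,2) U_def])
        show "c ! i \<notin> Y" if "c ! t \<in> S" "c ! t' \<in> S" "t < i" "i < t'" "t' < length c" for t t' i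
          using S01[OF that(2,5)] that(3,4) by linarith
      qed
      then obtain x where x: "x \<noteq> y" "x \<in> U"
          "\<And>q. graph_path (U - {x}) E q \<Longrightarrow> hd q = y \<Longrightarrow> last q \<notin> S"
        by blast
      define X where "X = insert x (set c - S)"
      have "card (set c - S) = length c - 2" using S cc by (simp add: card_Diff_subset finite_subset)
      then have "card X \<le> length c - 2 + 1" unfolding X_def by (simp add: card_insert_if)
      then have cX: "card X < k" using True len by simp
      obtain s where s: "s \<in> S" "s \<noteq> x" using c01 unfolding S_def by blast
      have "X \<subseteq> V" "y \<in> V - X" "s \<in> V - X"
        using x cV y yV s S(1) by (auto simp: X_def U_def)
      then obtain q where "graph_path (V - X) E q" "hd q = y" "last q = s"
        using k_connected_path[OF conn _ cX] by blast
      moreover have "V - X = U - {x}" by (auto simp: X_def U_def)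
      ultimately show False using x(3) s(1) by auto
    next
      case False
      define I where "I = {i. i < length c \<and> c ! i \<in> Y}"
      define seg where "seg t = Max {i \<in> I. i \<le> t}" for t
      define S where "S i = {c ! t | t. t < length c \<and> seg t = i}" for i
      define U where "U i = V - (set c - S i)" for i
      have I0: "0 \<in> I" using c(3) z(1) len by (auto simp: I_def)
      have finI: "finite I" by (simp add: I_def)
      have seg: "seg t \<in> I" "seg t \<le> t" "\<And>i. i \<in> I \<Longrightarrow> i \<le> t \<Longrightarrow> i \<le> seg t" for t
      proof -
        have "seg t \<in> {i \<in> I. i \<le> t}" unfolding seg_def using I0 finI by (intro Max_in) auto
        then show "seg t \<in> I" "seg t \<le> t" by auto
        show "i \<le> seg t" if "i \<in> I" "i \<le> t" for i
          unfolding seg_def using that finI by (intro Max_ge) auto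
      qed
      have seg_self: "seg i = i" if "i \<in> I" for i using seg(2)[of i] seg(3)[of i i] that by simp
      have S_iff: "c ! t \<in> S i \<longleftrightarrow> seg t = i" if "t < length c" for t i
        using that dc by (auto simp: S_def nth_eq_iff_index_eq)
      have "\<exists>x. x \<noteq> y \<and> x \<in> U i \<and> (\<forall>q. graph_path (U i - {x}) E q \<and> hd q = y \<longrightarrow> last q \<notin> S i)"
        if i: "i \<in> I" for i
      proof (rule fan[OF _ _ U_def])
        show "S i \<subseteq> set c" by (auto simp: S_def)
        show "S i \<noteq> {}" using seg_self[OF i] i by (auto simp: S_def I_def)
        show "c ! j \<notin> Y" if "c ! t \<in> S i" "c ! t' \<in> S i" "t < j" "j < t'" "t' < length c" for t t' j
        proof
          assume "c ! j \<in> Y"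
          then have "j \<in> I" using that by (auto simp: I_def)
          then have "j \<le> seg t'" using seg(3) that(4) by simp
          moreover have "seg t' = i" "seg t = i" using that S_iff by auto
          ultimately show False using seg(2)[of t] that(3) by simp
        qed
      qed
      then obtain x where x: "\<And>i. i \<in> I \<Longrightarrow> x i \<noteq> y" "\<And>i. i \<in> I \<Longrightarrow> x i \<in> U i"
        "\<And>i q. i \<in> I \<Longrightarrow> graph_path (U i - {x i}) E q \<Longrightarrow> hd q = y \<Longrightarrow> last q \<notin> S i"
        by metis
      define X where "X = x ` I"
      have "card I = card ((!) c ` I)"
        using dc by (intro card_image[symmetric]) (auto simp: inj_on_def I_def nth_eq_iff_index_eq)
      also have "\<dots> \<le> card (Y - {y})"
        using finY y(2) by (intro card_mono) (auto simp: I_def)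
      also have "\<dots> = k - 2" using finY y(1) Y(2) by simp
      finally have cX: "card X \<le> k - 2" using card_image_le[OF finI, of x] by (simp add: X_def)
      have "\<not> set c \<subseteq> X"
      proof
        assume "set c \<subseteq> X"
        then have "card (set c) \<le> card X" using finI by (intro card_mono) (auto simp: X_def)
        then show False using cX cc False k by simp
      qed
      then obtain v where v: "v \<in> set c" "v \<notin> X" by blast
      have XV: "X \<subseteq> V" using x(2) by (auto simp: X_def U_def)
      have "y \<in> V - X" "v \<in> V - X" using x(1) yV v cV by (auto simp: X_def)
      moreover have "card X < k" using cX k by linarith
      ultimately obtain p where p: "graph_path (V - X) E p" "hd p = y" "last p = v"
        using k_connected_path[OF conn XV] by blast
      have "p \<noteq> []" using p(1) by (auto simp: graph_path_def)
      then have "\<exists>u\<in>set p. u \<in> set c" using p(3) v(1) last_in_set by blast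
      then obtain a u b where a: "p = a @ u # b" "u \<in> set c" "\<forall>w\<in>set a. w \<notin> set c"
        using split_list_first_prop[of p "\<lambda>v. v \<in> set c"] by blast
      have "a \<noteq> []" using a(1,2) p(2) y(2) by (cases a) auto
      have "graph_path (V - X) E ((a @ [u]) @ b)" using p(1) a(1) by simp
      then have au: "graph_path (V - X) E (a @ [u])"
        by (cases "b = []") (simp_all add: graph_path_append del: append_assoc)
      obtain t where t: "t < length c" "u = c ! t" using a(2) by (auto simp: in_set_conv_nth)
      let ?i = "seg t"
      have uS: "u \<in> S ?i" using S_iff t by simp
      \<comment> \<open>Up to its first vertex on the cycle the path avoids all other segments, so
        it contradicts the choice of the separator \<open>x ?i\<close>.\<close>
      have "set (a @ [u]) \<subseteq> U ?i - {x ?i}"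
      proof -
        have "x ?i \<in> X" using seg(1) by (simp add: X_def)
        then show ?thesis using au a(3) uS by (auto simp: graph_path_def U_def)
      qed
      then have "graph_path (U ?i - {x ?i}) E (a @ [u])" using au by (auto simp: graph_path_def)
      moreover have "hd (a @ [u]) = y" using a(1) p(2) \<open>a \<noteq> []\<close> by simp
      ultimately have "last (a @ [u]) \<notin> S ?i" by (rule x(3)[OF seg(1)])
      then show False using uS by simp
    qed
  qed
  then show thesis using that c(1) by blast
qed

subsection \<open>The longest cycle\<close>

text \<open>If the cycle had fewer than \<open>k\<close> vertices, deleting all but one of them
  would show that this one has a neighbour off the cycle, and the rest of the graph would be
  connected. So a detour could be inserted between two consecutive vertices without losing
  any.\<close>

lemma k_le_longest_cycle:
  assumes conn: "k_connected k V E" and fin: "finite V"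
    and Y: "Y \<subseteq> V" "card Y = k - 1"
    and c: "graph_cycle V E c" "Y \<subseteq> set c"
    and longest: "\<And>c'. graph_cycle V E c' \<Longrightarrow> Y \<subseteq> set c' \<Longrightarrow> length c' \<le> length c"
  shows "k \<le> length c"
proof (rule ccontr)
  assume short: "\<not> k \<le> length c"
  have dc: "distinct c" and cV: "set c \<subseteq> V" and len: "length c \<ge> 3"
    using c(1) by (auto simp: graph_cycle_def graph_path_def)
  have cc: "card (set c) = length c" using dc by (rule distinct_card)
  have "card V > card (set c)" using short conn cc by (simp add: k_connected_def)
  then have "V \<noteq> set c" by auto
  then obtain h where h: "h \<in> V" "h \<notin> set c" using cV by blast
  have exit: "\<exists>x. x \<in> V - set c \<and> {u, x} \<in> E" if u: "u \<in> set c" for u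
  proof -
    have "card (set c - {u}) < k" using short cc u by simp
    moreover have "set c - {u} \<subseteq> V" "u \<in> V - (set c - {u})" "h \<in> V - (set c - {u})" "u \<noteq> h"
      using cV h u by auto
    ultimately obtain x where "x \<in> V - (set c - {u})" "x \<noteq> u" "{u, x} \<in> E"
      using k_connected_nbr[OF conn] by metis
    then show ?thesis by auto
  qed
  have c01: "c ! 0 \<in> set c" "c ! 1 \<in> set c" using len by (intro nth_mem; linarith)+
  obtain x0 x1 where x: "x0 \<in> V - set c" "{c ! 0, x0} \<in> E" "x1 \<in> V - set c" "{c ! 1, x1} \<in> E"
    using exit c01 by metis
  have "card (set c) < k" using short cc by simp
  then obtain r where r: "graph_path (V - set c) E r" "hd r = x0" "last r = x1"
    using k_connected_path[OF conn cV _ x(1,3)] by blast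
  have "r \<noteq> []" using r(1) by (auto simp: graph_path_def)
  have rr: "graph_path V E r" "set r \<inter> set c = {}" using r(1) by (auto simp: graph_path_def)
  have "graph_cycle V E (take (Suc 0) c @ r @ drop 1 c)"
    using len x(2,4) r(2,3) rr
    by (intro graph_cycle_detour[OF c(1)]) (auto simp: insert_commute)
  moreover have "set c \<subseteq> set (take (Suc 0) c @ r @ drop 1 c)" by (cases c) auto
  ultimately have "length (take (Suc 0) c @ r @ drop 1 c) \<le> length c"
    using c(2) by (intro longest) auto
  then show False using \<open>r \<noteq> []\<close> len by simp
qed

lemma longest_cycle_gapped:
  assumes conn: "k_connected k V E" and fin: "finite V" and k: "2 \<le> k"
    and Y: "Y \<subseteq> V" "card Y = k - 1"
    and c: "graph_cycle V E c" "Y \<subseteq> set c" "c ! 0 \<in> Y"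
    and longest: "\<And>c'. graph_cycle V E c' \<Longrightarrow> Y \<subseteq> set c' \<Longrightarrow> length c' \<le> length c"
  shows "gapped E k {i. 0 < i \<and> i < length c \<and> c ! i \<in> Y} (length c) (V - set c)
    (\<lambda>v. {i. i < length c \<and> {v, c ! i} \<in> E})"
proof -
  define H I N where "H = V - set c" and "I = {i. 0 < i \<and> i < length c \<and> c ! i \<in> Y}"
    and "N = (\<lambda>v. {i. i < length c \<and> {v, c ! i} \<in> E})"
  have dc: "distinct c" and cV: "set c \<subseteq> V" and len: "length c \<ge> 3" and cne: "c \<noteq> []"
    using c(1) by (auto simp: graph_cycle_def graph_path_def)
  have kc: "k \<le> length c" by (rule k_le_longest_cycle[OF conn fin Y c(1,2) longest])
  have finY: "finite Y" using Y(1) fin finite_subset by blast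
  have "gapped E k I (length c) H N"
    unfolding gapped_def
  proof (intro conjI allI impI ballI; (elim conjE)?)
    show "finite H" using fin by (simp add: H_def)
  next
    fix v show "finite (N v)" by (simp add: N_def)
  next
    show "finite I" by (simp add: I_def)
  next
    have "card I = card ((!) c ` I)"
      using dc by (intro card_image[symmetric]) (auto simp: inj_on_def I_def nth_eq_iff_index_eq)
    also have "\<dots> \<le> card (Y - {c ! 0})"
    proof (intro card_mono)
      have "c ! i \<noteq> c ! 0" if "i \<in> I" for i
        using that nth_eq_iff_index_eq[OF dc, of i 0] cne by (auto simp: I_def)
      then show "(!) c ` I \<subseteq> Y - {c ! 0}" by (auto simp: I_def)
    qed (use finY in simp)
    also have "\<dots> = k - 2" using c(3) finY Y(2) by simp
    finally show "card I + 2 \<le> k" using k by simp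
  next
    fix W assume W: "W \<subseteq> H" "W \<noteq> {}"
    have WV: "W \<subseteq> V" using W(1) by (auto simp: H_def)
    have finNW: "finite (\<Union>(N ` W))" by (rule finite_subset[of _ "{..<length c}"]) (auto simp: N_def)
    have eq: "nbrs E V W = nbrs E H W \<union> (!) c ` (\<Union>(N ` W))"
    proof
      show "nbrs E V W \<subseteq> nbrs E H W \<union> (!) c ` (\<Union>(N ` W))"
        by (auto simp: nbrs_def H_def N_def in_set_conv_nth image_iff)
      show "nbrs E H W \<union> (!) c ` (\<Union>(N ` W)) \<subseteq> nbrs E V W"
        using W(1) cV by (auto simp: nbrs_def H_def N_def)
    qed
    show "k \<le> card (nbrs E H W) + card (\<Union>(N ` W))"
    \<comment> \<open>The bound on boundaries requires a vertex outside \<open>W\<close> and its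
      boundary. Without one, every vertex of the cycle is adjacent to \<open>W\<close>, and
      \<open>k \<le> length c\<close> takes over.\<close>
    proof (cases "V \<subseteq> W \<union> nbrs E V W")
      case False
      then have "k \<le> card (nbrs E V W)"
        using k_connected_nbrs[OF conn fin WV W(2)] by blast
      also have "\<dots> \<le> card (nbrs E H W) + card ((!) c ` (\<Union>(N ` W)))"
        unfolding eq by (rule card_Un_le)
      also have "\<dots> \<le> card (nbrs E H W) + card (\<Union>(N ` W))"
        using finNW by (intro add_left_mono card_image_le)
      finally show ?thesis .
    next
      case True
      have "set c \<subseteq> (!) c ` (\<Union>(N ` W))"
      proof
        fix v assume v: "v \<in> set c"
        then have "v \<in> nbrs E V W" using True cV W(1) by (auto simp: H_def)
        then show "v \<in> (!) c ` (\<Union>(N ` W))" unfolding eq using v by (auto simp: nbrs_def H_def)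
      qed
      then have "card (set c) \<le> card ((!) c ` (\<Union>(N ` W)))" using finNW by (intro card_mono) auto
      also have "\<dots> \<le> card (\<Union>(N ` W))" using finNW by (rule card_image_le)
      finally show ?thesis using kc by (simp add: distinct_card[OF dc])
    qed
  next
    fix p t t' assume p: "graph_path H E p" "t \<in> N (hd p)" "t' \<in> N (last p)" "t < t'" "I \<inter> {t<..<t'} = {}"
    have tt: "t' < length c" "{c ! t, hd p} \<in> E" "{last p, c ! t'} \<in> E"
      using p(2,3) by (auto simp: N_def insert_commute)
    have pV: "graph_path V E p" "set p \<inter> set c = {}" using p(1) by (auto simp: graph_path_def H_def)
    let ?c = "take (Suc t) c @ p @ drop t' c"
    have "graph_cycle V E ?c"
      by (rule graph_cycle_detour[OF c(1) p(4) tt(1) pV tt(2,3)])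
    moreover have "Y \<subseteq> set ?c"
    proof
      fix v assume v: "v \<in> Y"
      then have "v \<in> set c" using c(2) by blast
      then obtain i where i: "i < length c" "v = c ! i" by (auto simp: in_set_conv_nth)
      \<comment> \<open>Position \<open>0\<close> is in \<open>Y\<close> but not in
        \<open>I\<close>; it is never strictly between \<open>t\<close> and
        \<open>t'\<close>.\<close>
      have "\<not> (t < i \<and> i < t')"
      proof
        assume "t < i \<and> i < t'"
        then have "i \<in> I \<inter> {t<..<t'}" using \<open>v \<in> Y\<close> i by (simp add: I_def)
        then show False using p(5) by blast
      qed
      then consider "i \<le> t" | "t' \<le> i" by linarith
      then show "v \<in> set ?c"
      proof cases
        case 1
        then have "v \<in> set (take (Suc t) c)"
          using i by (auto simp: in_set_conv_nth intro!: exI[of _ i])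
        then show ?thesis by simp
      next
        case 2
        then have "v \<in> set (drop t' c)"
          using i by (auto simp: in_set_conv_nth intro!: exI[of _ "i - t'"])
        then show ?thesis by simp
      qed
    qed
    ultimately have "length ?c \<le> length c" by (rule longest)
    then show "t + length p + 1 \<le> t'" using tt(1) p(4) by simp
  next
    fix p t t' assume p: "graph_path H E p" "t \<in> N (hd p)" "t' \<in> N (last p)"
    show "t + 2 \<le> length c + t'"
    proof (rule ccontr)
      assume "\<not> ?thesis"
      moreover have "t < length c" using p(2) by (simp add: N_def)
      ultimately have "t' = 0" "t = length c - 1" by auto
      then have e: "{last c, hd p} \<in> E" "{last p, hd c} \<in> E"
        using p(2,3) cne by (auto simp: N_def last_conv_nth hd_conv_nth insert_commute)
      have "graph_cycle V E (c @ p)"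
        using p(1) e by (intro graph_cycle_extend[OF c(1)]) (auto simp: graph_path_def H_def)
      then have "length (c @ p) \<le> length c" using c(2) by (intro longest) auto
      then show False using p(1) by (auto simp: graph_path_def)
    qed
  qed
  then show ?thesis by (simp add: H_def I_def N_def)
qed

section \<open>Edges as ordered pairs, and the final count\<close>

lemma simple_graph_card_arcs:
  assumes "simple_graph V E"
  shows "card (arcs E V V) = 2 * card E"
proof -
  have fin: "finite V" and E: "\<And>e. e \<in> E \<Longrightarrow> e \<subseteq> V \<and> card e = 2"
    using assms by (auto simp: simple_graph_def)
  have "E \<subseteq> Pow V" using E by auto
  then have finE: "finite E" using fin finite_subset by blast
  define A where "A e = {(u, v). u \<in> e \<and> v \<in> e \<and> u \<noteq> v}" for e :: "'a set"
  have cardA: "card (A e) = 2 \<and> A e \<subseteq> arcs E V V \<and> (\<forall>x\<in>A e. {fst x, snd x} = e)" if e: "e \<in> E" for e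
  proof -
    obtain u v where uv: "e = {u, v}" "u \<noteq> v" using E[OF e] by (auto simp: card_2_iff)
    then have "A e = {(u, v), (v, u)}" by (auto simp: A_def)
    then show ?thesis using uv E[OF e] e by (auto simp: arcs_def insert_commute)
  qed
  have "arcs E V V = (\<Union>e\<in>E. A e)"
  proof
    show "arcs E V V \<subseteq> (\<Union>e\<in>E. A e)"
    proof
      fix x assume "x \<in> arcs E V V"
      then obtain u v where x: "x = (u, v)" "{u, v} \<in> E" by (auto simp: arcs_def)
      then have "u \<noteq> v" using E[of "{u, v}"] by auto
      then show "x \<in> (\<Union>e\<in>E. A e)" using x by (auto simp: A_def intro!: bexI[of _ "{u, v}"])
    qed
    show "(\<Union>e\<in>E. A e) \<subseteq> arcs E V V" using cardA by blast
  qed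
  also have "card \<dots> = (\<Sum>e\<in>E. card (A e))"
  proof (rule card_UN_disjoint[OF finE])
    show "\<forall>e\<in>E. finite (A e)" using cardA by (metis card.infinite zero_neq_numeral)
    show "\<forall>e\<in>E. \<forall>f\<in>E. e \<noteq> f \<longrightarrow> A e \<inter> A f = {}"
      using cardA by blast
  qed
  also have "\<dots> = 2 * card E" using cardA by simp
  finally show ?thesis .
qed

theorem theorem8:
  fixes V Y :: "'a set" and E :: "'a set set" and k n :: nat
  assumes "simple_graph V E"
    and "card V = n"
    and "k \<ge> 2"
    and "k_connected k V E"
    and "Y \<subseteq> V"
    and "card Y = k - 1"
  shows "\<exists>c. through_cycle V E Y c \<and> real (length c) \<ge> 2 * real (card E) / (real n - 1)"
proof -
  have fin: "finite V" and loopless: "\<And>v. {v} \<notin> E"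
    using assms(1) by (auto simp: simple_graph_def)
  have n: "2 < n" using assms(2-4) by (simp add: k_connected_def)
  define good where "good c \<longleftrightarrow> graph_cycle V E c \<and> Y \<subseteq> set c" for c
  obtain c0 where "good c0"
    using cycle_through_set[OF assms(4) fin assms(3,5,6)] by (auto simp: good_def)
  moreover have "\<forall>c. good c \<longrightarrow> length c < n + 1"
    using graph_path_length[OF fin] assms(2) by (auto simp: good_def graph_cycle_def less_Suc_eq_le)
  ultimately obtain c1 where c1: "good c1" and longest: "\<And>c. good c \<Longrightarrow> length c \<le> length c1"
    using ex_has_greatest_nat[of good c0 length "n + 1"] by blast
  \<comment> \<open>By \<open>k \<ge> 2\<close>, \<open>Y\<close> is nonempty. Opening the cycle at
    one of its vertices leaves only \<open>k - 2\<close> others to block gaps.\<close>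
  obtain y where y: "y \<in> Y" using assms(3,6) by fastforce
  obtain c where c: "graph_cycle V E c" "set c = set c1" "length c = length c1" "c ! 0 = y"
    using graph_cycle_rotate[of V E c1 y] c1 y by (auto simp: good_def)
  have Yc: "Y \<subseteq> set c" using c1 c(2) by (simp add: good_def)
  define H where "H = V - set c"
  define N where "N = (\<lambda>v. {i. i < length c \<and> {v, c ! i} \<in> E})"
  have cV: "set c \<subseteq> V" and dc: "distinct c" using c(1) by (auto simp: graph_cycle_def graph_path_def)
  have "gapped E k {i. 0 < i \<and> i < length c \<and> c ! i \<in> Y} (length c) H N"
    unfolding H_def N_def using c y longest
    by (intro longest_cycle_gapped[OF assms(4) fin assms(3,5,6) c(1) Yc]) (auto simp: good_def)
  then have bound: "card (arcs E H H) + 2 * (\<Sum>v\<in>H. card (N v)) \<le> length c * card H"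
    using gapped_imp_gap_bound[OF loopless] by (simp add: gap_bound_def)
  have finH: "finite H" using fin by (simp add: H_def)
  have "card (N v) = card {u \<in> set c. {v, u} \<in> E}" for v
  proof (rule bij_betw_same_card)
    show "bij_betw ((!) c) (N v) {u \<in> set c. {v, u} \<in> E}"
      using dc by (auto simp: bij_betw_def N_def inj_on_def nth_eq_iff_index_eq in_set_conv_nth)
  qed
  then have "(\<Sum>v\<in>H. card (N v)) = card (arcs E H (set c))"
    using finH by (simp add: card_arcs_sum)
  moreover have "V = H \<union> set c" "H \<inter> set c = {}" using cV by (auto simp: H_def)
  then have "card (arcs E V V) = card (arcs E H H) + 2 * card (arcs E H (set c)) + card (arcs E (set c) (set c))"
    using card_arcs_Un[of H "set c" E] finH by simp
  moreover have "card (arcs E (set c) (set c)) \<le> length c * (length c - 1)"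
    using card_arcs_self_le[of "set c" E] loopless distinct_card[OF dc] by simp
  ultimately have "2 * card E \<le> length c * card H + length c * (length c - 1)"
    using bound simple_graph_card_arcs[OF assms(1)] by linarith
  also have "\<dots> = length c * (n - 1)"
  proof -
    have "card H = n - length c" "length c \<le> n" "3 \<le> length c"
      using cV fin c(1) assms(2) card_mono[OF fin cV]
      by (auto simp: H_def card_Diff_subset distinct_card[OF dc] graph_cycle_def)
    then have "card H + (length c - 1) = n - 1" by simp
    then show ?thesis by (metis add_mult_distrib2)
  qed
  finally have "real (2 * card E) \<le> real (length c * (n - 1))" by (rule of_nat_mono)
  then have "2 * real (card E) \<le> real (length c) * (real n - 1)" using n by (simp add: of_nat_diff)
  then have "2 * real (card E) / (real n - 1) \<le> real (length c)" using n by (simp add: divide_le_eq)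
  then show ?thesis using c(1) Yc unfolding through_cycle_def by blast
qed

end
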